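(* Let $K$ be a field and $\mathcal O$ a finite order ideal of terms in $K[x_1,\dots,x_n]$. Let $\mathfrak B\subset K[C]$ be the ideal defining the border marked scheme of $\mathcal O$ and $\mathfrak P\subset K[C\setminus\tilde C]$ be the ideal defining the Pommaret marked scheme of $\mathcal O$. Then there is an ideal $\mathfrak B'\subset K[C]$ generated by $|\tilde C|$ polynomials of the form $C_{ij}-q_{ij}$ with $C_{ij}\in\tilde C$ and $q_{ij}\in K[C\setminus\tilde C]$, such that $$\mathfrak B=\mathfrak P K[C]+\mathfrak B'.$$
   Context: $\mathbb T$ is the set of terms (monic monomials) in the variables $x_1<\dots<x_n$. For a term $\tau\ne1$, $\min(\tau)$ is the smallest variable dividing $\tau$. An order ideal is a (nonempty) set of terms closed under taking divisors. For a finite order ideal $\mathcal O=\{\sigma_1,\dots,\sigma_\ell\}$, the border is $\partial\mathcal O=\{x_i\tau:\tau\in\mathcal O,\ 1\le i\le n\}\setminus\mathcal O$. Write $\partial\mathcal O=\{\tau_1,\dots,\tau_m\}$, ordered increasingly by degree (terms of equal degree arbitrarily). The Pommaret basis $\mathcal P_{\mathcal O}\subseteq\partial\mathcal O$ is the set of terms $\sigma$ in the ideal $J$ generated by $\mathbb T\setminus\mathcal O$ with $\sigma/\min(\sigma)\notin J$. Generic marked sets: let $C=\{C_{ij}:1\le i\le m,\ 1\le j\le\ell\}$ be new parameters and $b_i=\tau_i-\sum_{j=1}^\ell C_{ij}\sigma_j\in K[C][x_1,\dots,x_n]$, with head term $\mathrm{Ht}(b_i)=\tau_i$. Put $\mathscr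 B=\{b_1,\dots,b_m\}$ (generic $\partial\mathcal O$-marked set), $\mathscr P=\{b_i:\tau_i\in\mathcal P_{\mathcal O}\}$ (generic $\mathcal P_{\mathcal O}$-marked set), and $\tilde C=\{C_{ij}:\tau_i\in\partial\mathcal O\setminus\mathcal P_{\mathcal O}\}$. Multiplicative sets: for the border structure, $\mathcal T_{\tau_i}=\{\mu\in\mathbb T:\tau_j\text{ does not divide }\tau_i\mu\text{ for all }j>i\}$ for $\tau_i\in\partial\mathcal O$; for the Pommaret structure, $\mathcal T_\alpha=\mathbb T\cap K[x_1,\dots,\min(\alpha)]$ for $\alpha\in\mathcal P_{\mathcal O}$. The cone of $\alpha$ is $\{\eta\alpha:\eta\in\mathcal T_\alpha\}$. In each structure, a reduction step replaces a polynomial $g$ by $g-c\,\eta\, b$, where $b$ is in the marked set, $\eta\in\mathcal T_{\mathrm{Ht}(b)}$, and $\eta\,\mathrm{Ht}(b)$ is in the support of $g$ with coefficient $c$. Both reduction relations (finitely many, possibly zero, steps) are Noetherian and confluent, so every polynomial reduces to a unique polynomial supported on $\mathcal O$ (an $\mathcal O$-reduced polynomial). $S(f,f')=\eta f-\eta'f'$, where $\eta\,\mathrm{Ht}(f)=\eta'\,\mathrm{Ht}(f')=\mathrm{lcm}(\mathrm{Ht}(f),\mathrm{Ht}(f'))$. Border marked scheme: a couple $(\alpha,\alpha')$ of border terms is a neighbour couple if $\alpha=x_j\alpha'$ for some $j$ or $x_i\alpha=x_j\alpha'$ for some $i,j$. For each $b_r,b_s\in\mathscr B$ whose head terms form a neighbour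 couple, let $h_{rs}$ be the $\mathcal O$-reduced polynomial to which $S(b_r,b_s)$ reduces by $\mathscr B$ in the border structure. $\mathfrak B\subset K[C]$ is the ideal generated by all coefficients (with respect to the terms in $x_1,\dots,x_n$) of the $h_{rs}$. The border marked scheme is $\mathrm{Spec}(K[C]/\mathfrak B)$. Pommaret marked scheme: a couple $(\alpha,\alpha')$ in $\mathcal P_{\mathcal O}$ is non-multiplicative if there is a variable $x_i\notin\mathcal T_\alpha$ with $x_i\alpha$ in the cone of $\alpha'$ (Pommaret structure). For each $p_r,p_s\in\mathscr P$ whose head terms form a non-multiplicative couple, let $h'_{rs}$ be the $\mathcal O$-reduced polynomial to which $S(p_r,p_s)$ reduces by $\mathscr P$ in the Pommaret structure. $\mathfrak P\subset K[C\setminus\tilde C]$ is the ideal generated by all coefficients (with respect to the terms in $x_1,\dots,x_n$) of the $h'_{rs}$. The Pommaret marked scheme is $\mathrm{Spec}(K[C\setminus\tilde C]/\mathfrak P)$. *)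

theory Defs
  imports "HOL-Library.Poly_Mapping" "HOL-Algebra.Ideal"
begin

text \<open>
  A term in variables from \<open>'v\<close> is its exponent vector, an element of the additively written
  monoid \<open>'v \<Rightarrow>\<^sub>0 nat\<close>: the product of terms is \<open>+\<close>, the term 1 is \<open>0\<close>, and the
  variable \<open>x\<close> is \<open>Poly_Mapping.single x 1\<close>. The \<open>\<le>\<close> that Poly_Mapping puts on terms is not
  divisibility and is not used. A polynomial over \<open>'a\<close> is an element of
  \<open>('v \<Rightarrow>\<^sub>0 nat) \<Rightarrow>\<^sub>0 'a\<close>; \<open>Poly_Mapping.single t c\<close> is \<open>c\<close> times the term \<open>t\<close>, and
  \<open>Poly_Mapping.keys p\<close> is the support of \<open>p\<close>.

  The variables \<open>x\<^sub>1 < \<dots> < x\<^sub>n\<close> are the elements of a type \<open>'x\<close> of class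
  \<open>finite\<close> and \<open>linorder\<close>, so \<open>n\<close> is \<open>CARD('x)\<close>.
\<close>

type_synonym 'v trm = "'v \<Rightarrow>\<^sub>0 nat"
type_synonym ('v, 'a) mpoly = "'v trm \<Rightarrow>\<^sub>0 'a"

text \<open>The parameters \<open>C\<^sub>i\<^sub>j\<close> are variables named by pairs of indices, which start at 0
  as list positions do.\<close>

type_synonym 'k cpoly = "(nat \<times> nat, 'k) mpoly"

abbreviation Var :: "'v \<Rightarrow> 'v trm" where
  "Var x \<equiv> Poly_Mapping.single x 1"

definition indets :: "('v, 'a::zero) mpoly \<Rightarrow> 'v set" where
  "indets p = (\<Union>t\<in>Poly_Mapping.keys p. Poly_Mapping.keys t)"

definition poly_ring :: "'v set \<Rightarrow> ('v, 'a::comm_ring_1) mpoly ring" where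
  "poly_ring V = \<lparr>carrier = {p. indets p \<subseteq> V}, mult = (*), one = 1, zero = 0, add = (+)\<rparr>"


definition trm_dvd :: "'v trm \<Rightarrow> 'v trm \<Rightarrow> bool" where
  "trm_dvd s t \<longleftrightarrow> (\<exists>u. t = s + u)"

definition trm_deg :: "'v trm \<Rightarrow> nat" where
  "trm_deg t = (\<Sum>x\<in>Poly_Mapping.keys t. Poly_Mapping.lookup t x)"

text \<open>Subtraction of exponents is truncated, so the exponents below are
  \<open>a + (b - a) = max a b\<close>.\<close>

definition trm_lcm :: "'v trm \<Rightarrow> 'v trm \<Rightarrow> 'v trm" where
  "trm_lcm s t = s + (t - s)"

definition min_var :: "'x::linorder trm \<Rightarrow> 'x" where
  "min_var t = Min (Poly_Mapping.keys t)"

definition order_ideal :: "'v trm set \<Rightarrow> bool" where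
  "order_ideal \<O> \<longleftrightarrow> \<O> \<noteq> {} \<and> (\<forall>t\<in>\<O>. \<forall>s. trm_dvd s t \<longrightarrow> s \<in> \<O>)"

definition border :: "'v trm set \<Rightarrow> 'v trm set" where
  "border \<O> = {Var x + t | x t. t \<in> \<O>} - \<O>"

text \<open>The ideal \<open>J\<close> of \<open>K[x\<^sub>1,\<dots>,x\<^sub>n]\<close> generated by the terms outside \<open>\<O>\<close>.\<close>

definition compl_ideal :: "'v trm set \<Rightarrow> ('v, 'k::field) mpoly set" where
  "compl_ideal \<O> = Idl\<^bsub>poly_ring UNIV\<^esub> {Poly_Mapping.single t 1 | t. t \<notin> \<O>}"

text \<open>The type argument supplies the field \<open>K\<close> over which \<open>J\<close> is formed.\<close>

definition pommaret_basis :: "'k::field itself \<Rightarrow> 'x::linorder trm set \<Rightarrow> 'x trm set" where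
  "pommaret_basis _ \<O> =
     {t. t \<noteq> 0 \<and>
         (Poly_Mapping.single t 1 :: ('x, 'k) mpoly) \<in> compl_ideal \<O> \<and>
         (Poly_Mapping.single (t - Var (min_var t)) 1 :: ('x, 'k) mpoly) \<notin> compl_ideal \<O>}"


text \<open>A marked set is a set of pairs of a head term and a polynomial, and a multiplicative
  structure \<open>T\<close> maps a head term to its set of multiplicative terms.\<close>

type_synonym ('v, 'a) marked = "'v trm \<times> ('v, 'a) mpoly"

definition red_step ::
  "('v, 'a::comm_ring_1) marked set \<Rightarrow> ('v trm \<Rightarrow> 'v trm set) \<Rightarrow>
     ('v, 'a) mpoly \<Rightarrow> ('v, 'a) mpoly \<Rightarrow> bool" where
  "red_step M T g g' \<longleftrightarrow>
     (\<exists>(\<alpha>, b)\<in>M. \<exists>\<eta>\<in>T \<alpha>. \<eta> + \<alpha> \<in> Poly_Mapping.keys g \<and>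
        g' = g - Poly_Mapping.single \<eta> (Poly_Mapping.lookup g (\<eta> + \<alpha>)) * b)"

definition reduces_to ::
  "('v, 'a::comm_ring_1) marked set \<Rightarrow> ('v trm \<Rightarrow> 'v trm set) \<Rightarrow> 'v trm set \<Rightarrow>
     ('v, 'a) mpoly \<Rightarrow> ('v, 'a) mpoly \<Rightarrow> bool" where
  "reduces_to M T \<O> g h \<longleftrightarrow> (red_step M T)\<^sup>*\<^sup>* g h \<and> Poly_Mapping.keys h \<subseteq> \<O>"

definition spoly :: "('v, 'a::comm_ring_1) marked \<Rightarrow> ('v, 'a) marked \<Rightarrow> ('v, 'a) mpoly" where
  "spoly p q =
     Poly_Mapping.single (trm_lcm (fst p) (fst q) - fst p) 1 * snd p -
     Poly_Mapping.single (trm_lcm (fst p) (fst q) - fst q) 1 * snd q"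

definition cone :: "('v trm \<Rightarrow> 'v trm set) \<Rightarrow> 'v trm \<Rightarrow> 'v trm set" where
  "cone T \<alpha> = {\<eta> + \<alpha> | \<eta>. \<eta> \<in> T \<alpha>}"

text \<open>\<open>ts\<close> enumerates the border, so that \<open>i\<close> below is the index of \<open>\<alpha>\<close>.\<close>

definition border_mult :: "'v trm list \<Rightarrow> 'v trm \<Rightarrow> 'v trm set" where
  "border_mult ts \<alpha> =
     {\<mu>. \<forall>i j. i < j \<and> j < length ts \<and> ts ! i = \<alpha> \<longrightarrow> \<not> trm_dvd (ts ! j) (\<alpha> + \<mu>)}"

definition pommaret_mult :: "'x::linorder trm \<Rightarrow> 'x trm set" where
  "pommaret_mult \<alpha> = {\<mu>. Poly_Mapping.keys \<mu> \<subseteq> {..min_var \<alpha>}}"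

definition neighbour :: "'v trm \<Rightarrow> 'v trm \<Rightarrow> bool" where
  "neighbour \<alpha> \<alpha>' \<longleftrightarrow>
     (\<exists>x. \<alpha> = Var x + \<alpha>') \<or> (\<exists>x y. Var x + \<alpha> = Var y + \<alpha>')"

definition nonmult_couple :: "'x::linorder trm \<Rightarrow> 'x trm \<Rightarrow> bool" where
  "nonmult_couple \<alpha> \<alpha>' \<longleftrightarrow>
     (\<exists>x. Var x \<notin> pommaret_mult \<alpha> \<and> Var x + \<alpha> \<in> cone pommaret_mult \<alpha>')"


text \<open>From here on \<open>ts\<close> enumerates the border and \<open>ss\<close> the order ideal, and generic marked
  polynomials have coefficients in the polynomials in the parameters.\<close>

definition gen_marked ::
  "'x trm list \<Rightarrow> 'x trm list \<Rightarrow> nat \<Rightarrow> ('x, 'k::field cpoly) mpoly" where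
  "gen_marked ts ss i =
     Poly_Mapping.single (ts ! i) 1 -
     (\<Sum>j<length ss. Poly_Mapping.single (ss ! j) (Poly_Mapping.single (Var (i, j)) 1))"

definition border_marked_set ::
  "'x trm list \<Rightarrow> 'x trm list \<Rightarrow> ('x, 'k::field cpoly) marked set" where
  "border_marked_set ts ss = {(ts ! i, gen_marked ts ss i) | i. i < length ts}"

definition pommaret_marked_set ::
  "'x::linorder trm list \<Rightarrow> 'x trm list \<Rightarrow> ('x, 'k::field cpoly) marked set" where
  "pommaret_marked_set ts ss =
     {(ts ! i, gen_marked ts ss i) | i.
        i < length ts \<and> ts ! i \<in> pommaret_basis TYPE('k) (set ss)}"

definition params :: "'x trm list \<Rightarrow> 'x trm list \<Rightarrow> (nat \<times> nat) set" where
  "params ts ss = {..<length ts} \<times> {..<length ss}"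

definition params_tilde ::
  "'k::field itself \<Rightarrow> 'x::linorder trm list \<Rightarrow> 'x trm list \<Rightarrow> (nat \<times> nat) set" where
  "params_tilde K ts ss =
     {(i, j) \<in> params ts ss. ts ! i \<notin> pommaret_basis K (set ss)}"

text \<open>In the next two definitions \<open>h\<close> is the unique reduced polynomial to which the
  S-polynomial reduces (the reductions are Noetherian and confluent).\<close>

definition border_scheme_ideal ::
  "'x trm list \<Rightarrow> 'x trm list \<Rightarrow> 'k::field cpoly set" where
  "border_scheme_ideal ts ss =
     Idl\<^bsub>poly_ring (params ts ss)\<^esub>
       {Poly_Mapping.lookup h t | h t. \<exists>p\<in>border_marked_set ts ss. \<exists>q\<in>border_marked_set ts ss.
          neighbour (fst p) (fst q) \<and>
          reduces_to (border_marked_set ts ss) (border_mult ts) (set ss) (spoly p q) h}"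

definition pommaret_scheme_ideal ::
  "'x::linorder trm list \<Rightarrow> 'x trm list \<Rightarrow> 'k::field cpoly set" where
  "pommaret_scheme_ideal ts ss =
     Idl\<^bsub>poly_ring (params ts ss - params_tilde TYPE('k) ts ss)\<^esub>
       {Poly_Mapping.lookup h t | h t. \<exists>p\<in>pommaret_marked_set ts ss. \<exists>q\<in>pommaret_marked_set ts ss.
          nonmult_couple (fst p) (fst q) \<and>
          reduces_to (pommaret_marked_set ts ss) pommaret_mult (set ss) (spoly p q) h}"

end

theory Submission
  imports Defs "HOL-Library.Multiset"
begin

text \<open>
  In the comments terms are multiplied as usual; in the formulas their product is \<open>+\<close>.

  Write \<open>N \<tau>\<close> for the tail \<open>\<Sum>\<^sub>j C\<^sub>i\<^sub>j \<sigma>\<^sub>j\<close> of the marked polynomial \<open>b \<tau> = \<tau> - N \<tau>\<close> with head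
  \<open>\<tau> = \<tau>\<^sub>i\<close>. Both inclusions come from one notion. Fix an ideal \<open>I\<close> of the ring of parameters. A
  normal form map modulo \<open>I\<close> is a linear map on polynomials which, up to coefficients in \<open>I\<close>,
  fixes the terms of \<open>\<O>\<close> and kills every multiple of every \<open>b \<tau>\<close>, whether multiplicative or not.
  If there is one, then a reduction step, in either structure, does not change its value modulo
  \<open>I\<close>, so it computes modulo \<open>I\<close> whatever a polynomial reduces to. Hence all coefficients of all reduced
  S-polynomials lie in \<open>I\<close> (\<open>reduced_spoly_in_ideal\<close>). Moreover \<open>\<tau>\<^sub>i\<close> has the same
  value as \<open>N \<tau>\<^sub>i\<close> and as the Pommaret normal form \<open>nf \<tau>\<^sub>i\<close>, so \<open>C\<^sub>i\<^sub>j\<close> is congruent to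
  the coefficient of \<open>\<sigma>\<^sub>j\<close> in \<open>nf \<tau>\<^sub>i\<close> (\<open>tail_cong_nf\<close>). That coefficient is \<open>q\<^sub>i\<^sub>j\<close>; it
  contains only parameters of the Pommaret marked set because only these polynomials are used to
  compute \<open>nf \<tau>\<^sub>i\<close>.

  Thus \<open>\<PP> K[C] + \<BB>' \<subseteq> \<BB>\<close> follows from a normal form map modulo \<open>\<BB>\<close>, and \<open>\<BB> \<subseteq> \<PP> K[C] + \<BB>'\<close> from
  one modulo \<open>\<PP> K[C] + \<BB>'\<close>.

  Modulo \<open>\<BB>\<close>: let \<open>x\<close> act on the free module with basis \<open>\<O>\<close> by multiplication with \<open>x\<close>
  followed by replacing border terms with their tails. The values of the commutators of these
  operators on the terms of \<open>\<O>\<close> are 0 or, up to sign, what the S-polynomials of neighbour couples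
  reduce to (\<open>mult_ops_commute\<close>), so the operators commute modulo \<open>\<BB>\<close> and the polynomial ring acts on
  the module. Letting a polynomial act on \<open>1\<close> is a normal form map (\<open>op_nf_normal_form_map\<close>).

  Modulo \<open>\<PP> K[C] + \<BB>'\<close>: the Pommaret normal form itself, which is defined by recursion and
  kills the multiplicative multiples of the \<open>b \<alpha>\<close> exactly, is a normal form map. The
  generators of \<open>\<PP>\<close> are the coefficients of the normal forms of \<open>x b \<alpha>\<close> with \<open>x\<close>
  nonmultiplicative for \<open>\<alpha>\<close>. All other multiples of \<open>b \<alpha>\<close> are handled by well-founded
  induction on the multiplier (\<open>L_pommaret_multiple\<close>), in the lexicographic order in which the
  largest variable counts most: rewriting \<open>x b \<alpha>\<close> uses only multipliers that are smaller
  than \<open>x\<close>. The generators of \<open>\<BB>'\<close> say that every border tail is congruent to the Pommaret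
  normal form of its head, which extends this from the Pommaret basis to the whole border
  (\<open>nf_normal_form_map\<close>).
\<close>

abbreviation (input) coef :: "('v \<Rightarrow>\<^sub>0 'a::zero) \<Rightarrow> 'v \<Rightarrow> 'a" where
  "coef \<equiv> Poly_Mapping.lookup"

abbreviation (input) supp :: "('v \<Rightarrow>\<^sub>0 'a::zero) \<Rightarrow> 'v set" where
  "supp \<equiv> Poly_Mapping.keys"

abbreviation (input) mon :: "'v \<Rightarrow> 'a::zero \<Rightarrow> 'v \<Rightarrow>\<^sub>0 'a" where
  "mon \<equiv> Poly_Mapping.single"

section \<open>Polynomials as finite sums of monomials\<close>

lemma poly_as_sum_of_monomials:
  fixes p :: "'t \<Rightarrow>\<^sub>0 'a::comm_monoid_add"
  shows "p = (\<Sum>t\<in>supp p. mon t (coef p t))"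
proof (rule poly_mapping_eqI)
  fix s
  have "coef (\<Sum>t\<in>supp p. mon t (coef p t)) s = (\<Sum>t\<in>supp p. if t = s then coef p s else 0)"
    by (auto simp: lookup_sum lookup_single when_def intro!: sum.cong)
  also have "\<dots> = coef p s"
    by (auto simp: in_keys_iff)
  finally show "coef p s = coef (\<Sum>t\<in>supp p. mon t (coef p t)) s" ..
qed

lemma supp_mult_subset:
  fixes p q :: "('v, 'a::comm_ring_1) mpoly"
  shows "supp (p * q) \<subseteq> {s + t | s t. s \<in> supp p \<and> t \<in> supp q}"
  using keys_mult[of p q] by auto

lemma supp_mon_mult_subset:
  fixes q :: "('v, 'a::comm_ring_1) mpoly"
  shows "supp (mon s c * q) \<subseteq> {s + t | t. t \<in> supp q}"
  using supp_mult_subset[of "mon s c" q] by (auto split: if_splits)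

lemma supp_diff_subset: "supp (p - q) \<subseteq> supp p \<union> supp (q :: 't \<Rightarrow>\<^sub>0 'a::ab_group_add)"
  by (auto simp: in_keys_iff lookup_minus)

text \<open>
  The linear map that sends the term \<open>t\<close> to \<open>f t\<close>. Linear maps are handled through their
  values on terms, so that they can be defined by recursion over terms; \<open>mon 0 c\<close> is the
  scalar \<open>c\<close>.
\<close>

definition lin_ext ::
  "('v trm \<Rightarrow> ('v, 'a::comm_ring_1) mpoly) \<Rightarrow> ('v, 'a) mpoly \<Rightarrow> ('v, 'a) mpoly" where
  "lin_ext f p = (\<Sum>t\<in>supp p. mon 0 (coef p t) * f t)"

lemma lin_ext_cong [fundef_cong]:
  "p = q \<Longrightarrow> (\<And>t. t \<in> supp q \<Longrightarrow> f t = g t) \<Longrightarrow> lin_ext f p = lin_ext g q"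
  by (simp add: lin_ext_def)

lemma lin_ext_superset:
  assumes "finite A" "supp p \<subseteq> A"
  shows "lin_ext f p = (\<Sum>t\<in>A. mon 0 (coef p t) * f t)"
  unfolding lin_ext_def
  by (rule sum.mono_neutral_left) (use assms in \<open>auto simp: in_keys_iff\<close>)

lemma lin_ext_0 [simp]: "lin_ext f 0 = 0"
  by (simp add: lin_ext_def)

lemma lin_ext_add: "lin_ext f (p + q) = lin_ext f p + lin_ext f q"
proof -
  let ?A = "supp p \<union> supp q"
  have "supp (p + q) \<subseteq> ?A"
    by (rule keys_add)
  then show ?thesis
    by (simp add: lin_ext_superset[of ?A] lookup_add single_add distrib_right sum.distrib)
qed

lemma lin_ext_diff: "lin_ext f (p - q) = lin_ext f p - lin_ext f q"
  using lin_ext_add[of f "p - q" q] by simp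

lemma lin_ext_sum: "lin_ext f (\<Sum>i\<in>A. p i) = (\<Sum>i\<in>A. lin_ext f (p i))"
  by (induction A rule: infinite_finite_induct) (auto simp: lin_ext_add)

lemma lin_ext_mon: "lin_ext f (mon t c) = mon 0 c * f t"
  by (subst lin_ext_superset[of "{t}"]) auto

lemma lin_ext_mon_mult:
  "lin_ext f (mon s c * p) = mon 0 c * lin_ext (\<lambda>t. f (s + t)) p"
proof -
  have "mon s c * p = (\<Sum>t\<in>supp p. mon (s + t) (c * coef p t))"
    by (subst (1) poly_as_sum_of_monomials[of p]) (simp add: sum_distrib_left mult_single)
  then have "lin_ext f (mon s c * p) = (\<Sum>t\<in>supp p. mon 0 (c * coef p t) * f (s + t))"
    by (simp add: lin_ext_sum lin_ext_mon)
  also have "\<dots> = mon 0 c * lin_ext (\<lambda>t. f (s + t)) p"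
    unfolding lin_ext_def sum_distrib_left
    by (intro sum.cong refl) (simp add: mult.assoc[symmetric] mult_single)
  finally show ?thesis .
qed

lemma lin_ext_compose_mon_mult:
  "lin_ext (\<lambda>t. f (s + t)) p = lin_ext f (mon s 1 * p)"
  by (simp add: lin_ext_mon_mult)

lemma lin_ext_scale: "lin_ext f (mon 0 c * p) = mon 0 c * lin_ext f p"
  by (simp add: lin_ext_mon_mult)

lemma lin_ext_id: "lin_ext (\<lambda>t. mon t 1) p = p"
  unfolding lin_ext_def
  by (subst (3) poly_as_sum_of_monomials) (simp add: mult_single)

lemma lin_ext_fixed:
  assumes "\<And>t. t \<in> supp p \<Longrightarrow> f t = mon t 1"
  shows "lin_ext f p = p"
  using lin_ext_cong[of p p f "\<lambda>t. mon t 1"] assms by (simp add: lin_ext_id)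

lemma lin_ext_lin_ext: "lin_ext f (lin_ext g p) = lin_ext (\<lambda>t. lin_ext f (g t)) p"
  by (simp add: lin_ext_def[of g] lin_ext_def[of "\<lambda>t. lin_ext f (g t)"] lin_ext_sum lin_ext_scale)

lemma supp_lin_ext:
  assumes "\<And>t. t \<in> supp p \<Longrightarrow> supp (f t) \<subseteq> A"
  shows "supp (lin_ext f p) \<subseteq> A"
proof -
  have "supp (mon 0 (coef p t) * f t) \<subseteq> A" if "t \<in> supp p" for t
    using supp_mon_mult_subset[of 0 "coef p t" "f t"] assms[OF that] by auto
  then show ?thesis
    using Poly_Mapping.keys_sum[of "\<lambda>t. mon 0 (coef p t) * f t" "supp p"]
    unfolding lin_ext_def by blast
qed

section \<open>Congruence modulo an ideal of coefficients\<close>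

definition coeffs_in :: "'a set \<Rightarrow> ('v, 'a::zero) mpoly \<Rightarrow> bool" where
  "coeffs_in A p \<longleftrightarrow> (\<forall>t. coef p t \<in> A)"

text \<open>
  \<open>I\<close> is an ideal of a subring \<open>S\<close> of the coefficients. Having \<open>S\<close> as a parameter
  serves two purposes: with a smaller \<open>S\<close>, and with \<open>I = S\<close>, the closure lemmas track which
  parameters occur in a polynomial.
\<close>

locale coeff_ideal =
  fixes S I :: "'a::comm_ring_1 set"
  assumes one_in: "1 \<in> S"
    and diff_in: "\<And>a b. a \<in> S \<Longrightarrow> b \<in> S \<Longrightarrow> a - b \<in> S"
    and mult_in: "\<And>a b. a \<in> S \<Longrightarrow> b \<in> S \<Longrightarrow> a * b \<in> S"
    and zero_ideal: "0 \<in> I"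
    and diff_ideal: "\<And>a b. a \<in> I \<Longrightarrow> b \<in> I \<Longrightarrow> a - b \<in> I"
    and mult_ideal: "\<And>a b. a \<in> S \<Longrightarrow> b \<in> I \<Longrightarrow> a * b \<in> I"
begin

lemma zero_in: "0 \<in> S"
  using diff_in[OF one_in one_in] by simp

lemma whole_ring: "coeff_ideal S S"
  by unfold_locales (auto intro: one_in diff_in mult_in zero_in)

lemma add_ideal: "a \<in> I \<Longrightarrow> b \<in> I \<Longrightarrow> a + b \<in> I"
  using diff_ideal[of a "0 - b"] diff_ideal[of 0 b] zero_ideal by simp

lemma coeffs_ideal_0 [simp]: "coeffs_in I 0"
  by (simp add: coeffs_in_def zero_ideal)

lemma coeffs_ideal_mon [simp]: "coeffs_in I (mon t c) \<longleftrightarrow> c \<in> I"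
  using zero_ideal by (auto simp: coeffs_in_def lookup_single when_def)

lemma coeffs_ideal_add: "coeffs_in I p \<Longrightarrow> coeffs_in I q \<Longrightarrow> coeffs_in I (p + q)"
  by (simp add: coeffs_in_def lookup_add add_ideal)

lemma coeffs_ideal_diff: "coeffs_in I p \<Longrightarrow> coeffs_in I q \<Longrightarrow> coeffs_in I (p - q)"
  by (simp add: coeffs_in_def lookup_minus diff_ideal)

lemma coeffs_ideal_sum: "(\<And>i. i \<in> A \<Longrightarrow> coeffs_in I (p i)) \<Longrightarrow> coeffs_in I (sum p A)"
  by (induction A rule: infinite_finite_induct) (auto intro: coeffs_ideal_add)

lemma coeffs_ideal_mult:
  assumes "coeffs_in S p" "coeffs_in I q"
  shows "coeffs_in I (p * q)"
proof -
  have "p * q = (\<Sum>s\<in>supp p. \<Sum>t\<in>supp q. mon (s + t) (coef p s * coef q t))"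
    by (subst poly_as_sum_of_monomials[of p], subst poly_as_sum_of_monomials[of q])
      (simp add: sum_product mult_single)
  moreover have "coeffs_in I \<dots>"
    using assms by (intro coeffs_ideal_sum) (auto simp: coeffs_in_def[of _ p] coeffs_in_def[of _ q] mult_ideal)
  ultimately show ?thesis by simp
qed

lemma coeffs_ideal_lin_ext:
  assumes "coeffs_in S p" "\<And>t. t \<in> supp p \<Longrightarrow> coeffs_in I (f t)"
  shows "coeffs_in I (lin_ext f p)"
  unfolding lin_ext_def
  by (intro coeffs_ideal_sum coeffs_ideal_mult)
    (use assms coeff_ideal.coeffs_ideal_mon[OF whole_ring] in \<open>auto simp: coeffs_in_def[of S p]\<close>)

lemma coeffs_ideal_lin_ext':
  assumes "coeffs_in I p" "\<And>t. t \<in> supp p \<Longrightarrow> coeffs_in S (f t)"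
  shows "coeffs_in I (lin_ext f p)"
  unfolding lin_ext_def
proof (intro coeffs_ideal_sum)
  fix t assume "t \<in> supp p"
  then show "coeffs_in I (mon 0 (coef p t) * f t)"
    using assms coeffs_ideal_mult[of "f t" "mon 0 (coef p t)"]
    by (simp add: mult.commute coeffs_in_def[of I p])
qed

definition cong_mod :: "('v, 'a) mpoly \<Rightarrow> ('v, 'a) mpoly \<Rightarrow> bool" (infix "\<approx>" 50) where
  "p \<approx> q \<longleftrightarrow> coeffs_in I (p - q)"

lemma cong_refl [simp]: "p \<approx> p"
  by (simp add: cong_mod_def)

lemma cong_sym: "p \<approx> q \<Longrightarrow> q \<approx> p"
  using coeffs_ideal_diff[of 0 "p - q"] by (simp add: cong_mod_def)

lemma cong_trans [trans]: "p \<approx> q \<Longrightarrow> q \<approx> r \<Longrightarrow> p \<approx> r"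
  using coeffs_ideal_add[of "p - q" "q - r"] by (simp add: cong_mod_def)

lemma cong_diff: "p \<approx> p' \<Longrightarrow> q \<approx> q' \<Longrightarrow> p - q \<approx> p' - q'"
  using coeffs_ideal_diff[of "p - p'" "q - q'"] by (simp add: cong_mod_def algebra_simps)

lemma cong_0_iff: "p \<approx> 0 \<longleftrightarrow> coeffs_in I p"
  by (simp add: cong_mod_def)

lemma cong_diff_0_iff: "p - q \<approx> 0 \<longleftrightarrow> p \<approx> q"
  by (simp add: cong_mod_def)

lemma lin_ext_cong_mod:
  assumes "coeffs_in S p" "\<And>t. t \<in> supp p \<Longrightarrow> f t \<approx> g t"
  shows "lin_ext f p \<approx> lin_ext g p"
proof -
  have "lin_ext f p - lin_ext g p = lin_ext (\<lambda>t. f t - g t) p"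
    by (simp add: lin_ext_def sum_subtractf algebra_simps)
  then show ?thesis
    using coeffs_ideal_lin_ext[of p "\<lambda>t. f t - g t"] assms by (simp add: cong_mod_def)
qed

lemma lin_ext_cong_arg:
  assumes "p \<approx> q" "\<And>t. coeffs_in S (f t)"
  shows "lin_ext f p \<approx> lin_ext f q"
  using coeffs_ideal_lin_ext'[of "p - q" f] assms by (simp add: cong_mod_def lin_ext_diff)

lemma cong_scale: "c \<in> S \<Longrightarrow> p \<approx> q \<Longrightarrow> mon 0 c * p \<approx> mon 0 c * q"
  using coeffs_ideal_mult[of "mon 0 c" "p - q"]
  by (simp add: cong_mod_def right_diff_distrib coeff_ideal.coeffs_ideal_mon[OF whole_ring])

lemmas coeffs_ring_simps [simp] =
  coeff_ideal.coeffs_ideal_0[OF whole_ring] coeff_ideal.coeffs_ideal_mon[OF whole_ring]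
lemmas coeffs_ring_diff = coeff_ideal.coeffs_ideal_diff[OF whole_ring]
lemmas coeffs_ring_sum = coeff_ideal.coeffs_ideal_sum[OF whole_ring]
lemmas coeffs_ring_mult = coeff_ideal.coeffs_ideal_mult[OF whole_ring]
lemmas coeffs_ring_lin_ext = coeff_ideal.coeffs_ideal_lin_ext[OF whole_ring]

end

section \<open>The lexicographic order in which the largest variable is most significant\<close>

definition lex_less :: "'x::linorder trm \<Rightarrow> 'x trm \<Rightarrow> bool" where
  "lex_less s t \<longleftrightarrow> (\<exists>x. coef s x < coef t x \<and> (\<forall>y>x. coef s y = coef t y))"

lemma lex_less_trans:
  assumes "lex_less s t" "lex_less t u" shows "lex_less s u"
proof -
  from assms obtain x y where x: "coef s x < coef t x" "\<forall>z>x. coef s z = coef t z"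
    and y: "coef t y < coef u y" "\<forall>z>y. coef t z = coef u z"
    unfolding lex_less_def by blast
  have "coef s (max x y) < coef u (max x y)"
  proof (cases x y rule: linorder_cases)
    case less
    then show ?thesis using x(2) y(1) by (simp add: max_absorb2)
  next
    case equal
    then show ?thesis using x(1) y(1) by simp
  next
    case greater
    then have "max x y = x" "coef t x = coef u x" using y(2) by (simp_all add: max_absorb1)
    then show ?thesis using x(1) by simp
  qed
  moreover have "\<forall>z>max x y. coef s z = coef u z"
    using x y by auto
  ultimately show ?thesis
    unfolding lex_less_def by blast
qed

lemma lex_less_add_left: "lex_less s t \<Longrightarrow> lex_less (u + s) (u + t)"
  by (auto simp: lex_less_def lookup_add)

lemma lex_less_total:
  fixes s t :: "'x::{finite,linorder} trm"
  shows "s = t \<or> lex_less s t \<or> lex_less t s"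
proof (cases "s = t")
  case False
  let ?D = "{x. coef s x \<noteq> coef t x}"
  have "?D \<noteq> {}"
    using False by (auto intro: poly_mapping_eqI)
  then have "Max ?D \<in> ?D"
    by (rule Max_in[OF finite])
  then obtain x where x: "x = Max ?D" "coef s x \<noteq> coef t x"
    by blast
  have "coef s y = coef t y" if "y > x" for y
  proof (rule ccontr)
    assume "coef s y \<noteq> coef t y"
    then have "y \<le> x"
      unfolding x(1) by (intro Max_ge) simp_all
    then show False
      using that by simp
  qed
  then show ?thesis
    using x(2) unfolding lex_less_def by (metis linorder_neqE_nat)
qed simp

text \<open>
  Listing the exponents from the largest variable to the smallest embeds the order into the
  lexicographic order on lists of a fixed length.
\<close>

lemma wf_lex_less: "wf {(s, t :: 'x::{finite,linorder} trm). lex_less s t}"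
proof -
  define vs where "vs = rev (sorted_list_of_set (UNIV :: 'x set))"
  have vs: "set vs = UNIV" "sorted_wrt (>) vs"
    by (simp_all add: vs_def sorted_wrt_rev)
  have "(map (coef s) vs, map (coef t) vs) \<in> lexn less_than (length vs)"
    if "lex_less s t" for s t :: "'x trm"
  proof -
    from that obtain x where x: "coef s x < coef t x" "\<forall>y>x. coef s y = coef t y"
      by (auto simp: lex_less_def)
    obtain as bs where split: "vs = as @ x # bs"
      using vs(1) split_list[of x vs] by auto
    then have "\<forall>y\<in>set as. y > x"
      using vs(2) by (auto simp: sorted_wrt_append)
    then have "map (coef s) as = map (coef t) as"
      using x by simp
    then have "map (coef s) vs = map (coef t) as @ coef s x # map (coef s) bs"
      "map (coef t) vs = map (coef t) as @ coef t x # map (coef t) bs"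
      using split by simp_all
    moreover have "length (map (coef s) vs) = length vs" "length (map (coef t) vs) = length vs"
      by simp_all
    ultimately show ?thesis
      using x(1) unfolding lexn_conv by blast
  qed
  then have "{(s, t). lex_less s t} \<subseteq> inv_image (lexn less_than (length vs)) (\<lambda>s. map (coef s) vs)"
    by (auto simp only: inv_image_def mem_Collect_eq split: prod.splits)
  then show ?thesis
    by (rule wf_subset[OF wf_inv_image[OF wf_lexn[OF wf_less_than]]])
qed


section \<open>The Pommaret cones partition the complement of the order ideal\<close>

lemma trm_dvd_iff: "trm_dvd s t \<longleftrightarrow> (\<forall>x. coef s x \<le> coef t x)"
proof
  assume "\<forall>x. coef s x \<le> coef t x"
  then have "t = s + (t - s)"
    by (intro poly_mapping_eqI) (simp add: lookup_add lookup_minus)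
  then show "trm_dvd s t"
    unfolding trm_dvd_def by blast
qed (auto simp: trm_dvd_def lookup_add)

lemma supp_trm_add: "supp (s + t :: 'v trm) = supp s \<union> supp t"
  by (auto simp: in_keys_iff lookup_add)

lemma Var_add_minus:
  assumes "x \<in> supp t" shows "Var x + (t - Var x) = (t :: 'v trm)"
  using assms by (intro poly_mapping_eqI)
    (auto simp: lookup_add lookup_minus lookup_single when_def in_keys_iff)

lemma min_var_in: "t \<noteq> 0 \<Longrightarrow> min_var t \<in> supp t"
  unfolding min_var_def by (rule Min_in) simp_all

lemma min_var_le: "x \<in> supp t \<Longrightarrow> min_var t \<le> x"
  unfolding min_var_def by (rule Min_le) simp_all

lemma min_var_add:
  fixes s t :: "'x::linorder trm"
  assumes "s \<noteq> 0" "t \<noteq> 0"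
  shows "min_var (s + t) = min (min_var s) (min_var t)"
  using assms unfolding min_var_def by (simp add: supp_trm_add Min_Un)

lemma trm_deg_add: "trm_deg (s + t :: 'v trm) = trm_deg s + trm_deg t"
proof -
  have *: "trm_deg u = (\<Sum>x\<in>supp s \<union> supp t. coef u x)" if "supp u \<subseteq> supp s \<union> supp t" for u
    unfolding trm_deg_def using that
    by (intro sum.mono_neutral_left) (auto simp: in_keys_iff)
  show ?thesis
    using *[of "s + t"] *[of s] *[of t] by (simp add: supp_trm_add lookup_add sum.distrib)
qed

lemma trm_deg_Var [simp]: "trm_deg (Var x) = 1"
  by (simp add: trm_deg_def)

lemma Var_nonzero [simp]: "Var x \<noteq> (0 :: 'v trm)"
  by (simp flip: Poly_Mapping.keys_eq_empty)

locale term_order_ideal =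
  fixes \<O> :: "'x::{finite,linorder} trm set"
  assumes order_ideal: "order_ideal \<O>"
begin

lemma dvd_closed: "t \<in> \<O> \<Longrightarrow> trm_dvd s t \<Longrightarrow> s \<in> \<O>"
  using order_ideal by (auto simp: order_ideal_def)

lemma factor_in: "s + t \<in> \<O> \<Longrightarrow> s \<in> \<O>" "s + t \<in> \<O> \<Longrightarrow> t \<in> \<O>"
  using dvd_closed[of "s + t"] by (auto simp: trm_dvd_iff lookup_add)

lemma zero_in_O: "0 \<in> \<O>"
  using order_ideal by (auto simp: order_ideal_def trm_dvd_iff)

definition P :: "'x trm set" where
  "P = {t. t \<notin> \<O> \<and> t - Var (min_var t) \<in> \<O>}"

lemma P_nonzero: "\<alpha> \<in> P \<Longrightarrow> \<alpha> \<noteq> 0"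
  using zero_in_O by (auto simp: P_def)

lemma P_subset_border: "P \<subseteq> border \<O>"
proof
  fix t assume t: "t \<in> P"
  then have "t = Var (min_var t) + (t - Var (min_var t))"
    using Var_add_minus[OF min_var_in[OF P_nonzero[OF t]]] by simp
  with t show "t \<in> border \<O>"
    unfolding border_def P_def by blast
qed

lemma pommaret_mult_add: "\<mu> \<in> pommaret_mult \<alpha> \<Longrightarrow> \<nu> \<in> pommaret_mult \<alpha> \<Longrightarrow> \<mu> + \<nu> \<in> pommaret_mult \<alpha>"
  by (auto simp: pommaret_mult_def supp_trm_add)

text \<open>
  Dividing a term outside \<open>\<O>\<close> by its smallest variable as long as the result stays outside
  \<open>\<O>\<close> ends in the Pommaret basis, and the variables divided out are no larger than the smallest
  variable of what remains.
\<close>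

lemma pommaret_cover:
  "t \<notin> \<O> \<Longrightarrow> \<exists>\<eta> \<alpha>. \<alpha> \<in> P \<and> \<eta> \<in> pommaret_mult \<alpha> \<and> t = \<eta> + \<alpha>"
proof (induction "trm_deg t" arbitrary: t rule: less_induct)
  case less
  then have nz: "t \<noteq> 0" using zero_in_O by auto
  define x where "x = min_var t"
  have t: "t = Var x + (t - Var x)"
    using Var_add_minus[OF min_var_in[OF nz]] by (simp add: x_def)
  show ?case
  proof (cases "t - Var x \<in> \<O>")
    case True
    then have "t \<in> P" using less.prems by (simp add: P_def x_def)
    moreover have "0 \<in> pommaret_mult t" by (simp add: pommaret_mult_def)
    ultimately show ?thesis by force
  next
    case False
    have "trm_deg (t - Var x) < trm_deg t"
      by (subst (2) t) (simp only: trm_deg_add trm_deg_Var)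
    from less.hyps[OF this False] obtain \<eta> \<alpha> where
      *: "\<alpha> \<in> P" "\<eta> \<in> pommaret_mult \<alpha>" "t - Var x = \<eta> + \<alpha>" by blast
    have "t = (Var x + \<eta>) + \<alpha>"
      using t *(3) by (simp add: add.assoc)
    moreover from this have "supp \<alpha> \<subseteq> supp t" by (auto simp: supp_trm_add)
    with min_var_in[OF P_nonzero[OF *(1)]] have "x \<le> min_var \<alpha>"
      by (auto simp: x_def intro: min_var_le)
    then have "Var x \<in> pommaret_mult \<alpha>"
      by (simp add: pommaret_mult_def)
    ultimately show ?thesis
      using *(1,2) pommaret_mult_add by blast
  qed
qed

text \<open>
  If \<open>\<eta> = \<eta>'\<close>, then \<open>\<beta> = \<alpha>'\<close>. Otherwise, at the largest variable \<open>x\<close> where \<open>\<eta>\<close> and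
  \<open>\<eta>'\<close> differ, either \<open>\<eta>'\<close> has the smaller exponent, or \<open>x\<close> divides the multiplicative term \<open>\<eta>'\<close>, so that \<open>\<alpha>'\<close> has no variable below
  \<open>x\<close>, while from \<open>x\<close> upwards its exponents are at most those of \<open>\<beta>\<close>. This comparison gives
  both the uniqueness of the Pommaret decomposition and the termination of Pommaret reduction.
\<close>

lemma lex_less_or_dvd:
  fixes \<eta> \<eta>' :: "'x trm"
  assumes eq: "\<eta> + \<beta> = \<eta>' + \<alpha>'" and mult: "\<eta>' \<in> pommaret_mult \<alpha>'"
  shows "lex_less \<eta>' \<eta> \<or> trm_dvd \<alpha>' \<beta>"
proof -
  have sum: "coef \<eta> y + coef \<beta> y = coef \<eta>' y + coef \<alpha>' y" for y
    using arg_cong[OF eq, of "\<lambda>t. coef t y"] by (simp add: lookup_add)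
  consider "lex_less \<eta>' \<eta>" | "\<eta>' = \<eta>" | "lex_less \<eta> \<eta>'"
    using lex_less_total[of \<eta>' \<eta>] by blast
  then show ?thesis
  proof cases
    case 2
    with sum show ?thesis by (auto simp: trm_dvd_iff)
  next
    case 3
    then obtain x where x: "coef \<eta> x < coef \<eta>' x" "\<forall>y>x. coef \<eta> y = coef \<eta>' y"
      by (auto simp: lex_less_def)
    then have "x \<in> supp \<eta>'"
      by (simp add: in_keys_iff)
    then have "x \<le> min_var \<alpha>'"
      using mult by (auto simp: pommaret_mult_def)
    have "coef \<alpha>' y \<le> coef \<beta> y" for y
    proof (cases y x rule: linorder_cases)
      case less
      with \<open>x \<le> min_var \<alpha>'\<close> have "y \<notin> supp \<alpha>'"
        using min_var_le[of y \<alpha>'] by auto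
      then show ?thesis by (simp add: in_keys_iff)
    next
      case equal
      then show ?thesis using sum[of x] x(1) by simp
    next
      case greater
      then show ?thesis using sum[of y] x(2) by simp
    qed
    then show ?thesis by (simp add: trm_dvd_iff)
  qed simp
qed

lemma lex_less_of_order_ideal:
  fixes \<eta> \<eta>' :: "'x trm"
  assumes "\<eta> + \<sigma> = \<eta>' + \<alpha>'" "\<eta>' \<in> pommaret_mult \<alpha>'" "\<sigma> \<in> \<O>" "\<alpha>' \<in> P"
  shows "lex_less \<eta>' \<eta>"
  using lex_less_or_dvd[OF assms(1,2)] dvd_closed[OF assms(3), of \<alpha>'] assms(4)
  by (auto simp: P_def)

text \<open>
  If \<open>u\<close> were not 1, its smallest variable would be the smallest variable of \<open>\<alpha> u\<close>, so \<open>\<alpha>\<close>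
  would divide \<open>\<alpha> u / min (\<alpha> u)\<close>, which lies in \<open>\<O>\<close>.
\<close>

lemma pommaret_unique_aux:
  assumes eq: "\<eta> + \<alpha> = \<eta>' + (\<alpha> + u)" and mult: "\<eta> \<in> pommaret_mult \<alpha>"
    and P: "\<alpha> \<in> P" "\<alpha> + u \<in> P"
  shows "u = 0"
proof (rule ccontr)
  assume u: "u \<noteq> 0"
  define x where "x = min_var u"
  have "\<eta> = \<eta>' + u"
    using eq by (simp add: algebra_simps)
  then have "supp u \<subseteq> {..min_var \<alpha>}"
    using mult by (auto simp: pommaret_mult_def supp_trm_add)
  then have "x \<le> min_var \<alpha>"
    using min_var_in[OF u] by (auto simp: x_def)
  then have "min_var (\<alpha> + u) = x"
    using min_var_add[OF P_nonzero[OF P(1)] u] by (simp add: x_def min_absorb2)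
  moreover have "\<alpha> + u = Var x + (\<alpha> + (u - Var x))"
    using Var_add_minus[OF min_var_in[OF u]] by (metis add.left_commute x_def)
  ultimately have "\<alpha> + (u - Var x) \<in> \<O>"
    using P(2) by (simp add: P_def)
  then show False
    using factor_in(1) P(1) by (auto simp: P_def)
qed

lemma pommaret_unique:
  assumes eq: "\<eta> + \<alpha> = \<eta>' + \<alpha>'"
    and mult: "\<eta> \<in> pommaret_mult \<alpha>" "\<eta>' \<in> pommaret_mult \<alpha>'"
    and P: "\<alpha> \<in> P" "\<alpha>' \<in> P"
  shows "\<eta> = \<eta>' \<and> \<alpha> = \<alpha>'"
proof -
  have "\<not> (lex_less \<eta>' \<eta> \<and> lex_less \<eta> \<eta>')"
    using lex_less_trans[of \<eta> \<eta>' \<eta>] by (auto simp: lex_less_def)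
  then consider "trm_dvd \<alpha>' \<alpha>" | "trm_dvd \<alpha> \<alpha>'"
    using lex_less_or_dvd[OF eq mult(2)] lex_less_or_dvd[OF eq[symmetric] mult(1)] by blast
  then have "\<alpha> = \<alpha>'"
  proof cases
    case 1
    then obtain u where "\<alpha> = \<alpha>' + u" by (auto simp: trm_dvd_def)
    then show ?thesis
      using pommaret_unique_aux[of \<eta>' \<alpha>' \<eta> u] eq mult(2) P by simp
  next
    case 2
    then obtain u where "\<alpha>' = \<alpha> + u" by (auto simp: trm_dvd_def)
    then show ?thesis
      using pommaret_unique_aux[of \<eta> \<alpha> \<eta>' u] eq mult(1) P by simp
  qed
  then show ?thesis using eq by simp
qed

definition cone_mult :: "'x trm \<Rightarrow> 'x trm" where
  "cone_mult t = (THE \<eta>. \<exists>\<alpha>\<in>P. \<eta> \<in> pommaret_mult \<alpha> \<and> t = \<eta> + \<alpha>)"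

definition cone_head :: "'x trm \<Rightarrow> 'x trm" where
  "cone_head t = t - cone_mult t"

lemma cone_mult_eq:
  assumes "\<alpha> \<in> P" "\<eta> \<in> pommaret_mult \<alpha>"
  shows "cone_mult (\<eta> + \<alpha>) = \<eta>" "cone_head (\<eta> + \<alpha>) = \<alpha>"
proof -
  show *: "cone_mult (\<eta> + \<alpha>) = \<eta>"
    unfolding cone_mult_def
  proof (rule the_equality)
    show "\<exists>\<alpha>'\<in>P. \<eta> \<in> pommaret_mult \<alpha>' \<and> \<eta> + \<alpha> = \<eta> + \<alpha>'"
      using assms by blast
    show "\<eta>' = \<eta>" if "\<exists>\<alpha>'\<in>P. \<eta>' \<in> pommaret_mult \<alpha>' \<and> \<eta> + \<alpha> = \<eta>' + \<alpha>'" for \<eta>'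
      using that pommaret_unique[of \<eta> \<alpha> \<eta>'] assms by blast
  qed
  show "cone_head (\<eta> + \<alpha>) = \<alpha>"
    unfolding cone_head_def * by simp
qed

lemma cone_decomp:
  assumes "t \<notin> \<O>"
  shows "cone_head t \<in> P" "cone_mult t \<in> pommaret_mult (cone_head t)" "cone_mult t + cone_head t = t"
proof -
  from pommaret_cover[OF assms] obtain \<eta> \<alpha> where
    "\<alpha> \<in> P" "\<eta> \<in> pommaret_mult \<alpha>" "t = \<eta> + \<alpha>" by blast
  then show "cone_head t \<in> P" "cone_mult t \<in> pommaret_mult (cone_head t)"
    "cone_mult t + cone_head t = t"
    using cone_mult_eq by simp_all
qed

text \<open>
  Reducing \<open>\<eta> \<alpha>\<close> produces terms \<open>\<eta> \<sigma>\<close> with \<open>\<sigma> \<in> \<O>\<close>; their multipliers are smaller than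
  \<open>\<eta>\<close>. This is why Pommaret reduction terminates.
\<close>

lemma cone_mult_less:
  assumes "\<sigma> \<in> \<O>" "\<eta> + \<sigma> \<notin> \<O>"
  shows "lex_less (cone_mult (\<eta> + \<sigma>)) \<eta>"
  using lex_less_of_order_ideal[of \<eta> \<sigma> "cone_mult (\<eta> + \<sigma>)" "cone_head (\<eta> + \<sigma>)"]
    cone_decomp[OF assms(2)] assms(1) by simp

text \<open>
  These facts make \<open>x \<alpha>\<close> the least common multiple of \<open>\<alpha>\<close> and the head of the cone of
  \<open>x \<alpha>\<close>, and make the induction over multipliers in \<open>L_pommaret_multiple\<close> work.
\<close>

lemma nonmult_cone:
  assumes \<alpha>: "\<alpha> \<in> P" and x: "Var x \<notin> pommaret_mult \<alpha>"
  shows "Var x + \<alpha> \<notin> \<O>" "lex_less (cone_mult (Var x + \<alpha>)) (Var x)"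
    "\<not> trm_dvd (cone_head (Var x + \<alpha>)) \<alpha>"
proof -
  show notin: "Var x + \<alpha> \<notin> \<O>"
    using \<alpha> factor_in(2) by (auto simp: P_def)
  define \<eta> \<alpha>' where "\<eta> = cone_mult (Var x + \<alpha>)" and "\<alpha>' = cone_head (Var x + \<alpha>)"
  have dec: "\<alpha>' \<in> P" "\<eta> \<in> pommaret_mult \<alpha>'" "\<eta> + \<alpha>' = Var x + \<alpha>"
    using cone_decomp[OF notin] by (simp_all add: \<eta>_def \<alpha>'_def)
  show ndvd: "\<not> trm_dvd \<alpha>' \<alpha>"
  proof
    assume "trm_dvd \<alpha>' \<alpha>"
    then obtain u where u: "\<alpha> = \<alpha>' + u" by (auto simp: trm_dvd_def)
    then have "\<eta> = Var x + u"
      using dec(3) by (simp add: algebra_simps)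
    then have "u \<in> pommaret_mult \<alpha>'" "Var x \<in> pommaret_mult \<alpha>'"
      using dec(2) by (auto simp: pommaret_mult_def supp_trm_add)
    moreover have "u + \<alpha>' = 0 + \<alpha>" "0 \<in> pommaret_mult \<alpha>"
      using u by (simp_all add: add.commute pommaret_mult_def)
    ultimately have "\<alpha>' = \<alpha>"
      using pommaret_unique dec(1) \<alpha> by blast
    with x \<open>Var x \<in> pommaret_mult \<alpha>'\<close> show False by simp
  qed
  show "lex_less \<eta> (Var x)"
    using lex_less_or_dvd[of "Var x" \<alpha> \<eta> \<alpha>'] dec ndvd by simp
qed

end


section \<open>Normal forms with respect to the Pommaret structure\<close>

text \<open>
  Marked polynomials over an arbitrary commutative ring, with one tail for each border term, so
  that the indices of the parameters enter only when the generic marked sets are plugged in.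
\<close>

locale marked_border = term_order_ideal \<O>
  for \<O> :: "'x::{finite,linorder} trm set" +
  fixes N :: "'x trm \<Rightarrow> ('x, 'a::comm_ring_1) mpoly"
  assumes tail_supp: "\<tau> \<in> border \<O> \<Longrightarrow> supp (N \<tau>) \<subseteq> \<O>"
begin

definition b :: "'x trm \<Rightarrow> ('x, 'a) mpoly" where
  "b \<tau> = mon \<tau> 1 - N \<tau>"

lemma mon_mult_b: "mon \<eta> c * b \<tau> = mon (\<eta> + \<tau>) c - mon \<eta> c * N \<tau>"
  by (simp add: b_def right_diff_distrib mult_single)

text \<open>
  Pommaret reduction of a single term: replace \<open>\<eta> \<alpha>\<close> by \<open>\<eta> N \<alpha>\<close> and go on term by term. Giving
  the result by recursion, rather than as the limit of a reduction, makes linearity immediate and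
  dispenses with a proof of confluence.
\<close>

function nf :: "'x trm \<Rightarrow> ('x, 'a) mpoly" where
  "nf t = (if t \<in> \<O> then mon t 1 else lin_ext nf (mon (cone_mult t) 1 * N (cone_head t)))"
  by pat_completeness auto

termination
proof (relation "inv_image (less_than <*lex*> {(s, t). lex_less s t})
    (\<lambda>t. (if t \<in> \<O> then 0 else 1 :: nat, cone_mult t))")
  show "wf (inv_image (less_than <*lex*> {(s, t :: 'x trm). lex_less s t})
    (\<lambda>t. (if t \<in> \<O> then 0 else 1 :: nat, cone_mult t)))"
    by (intro wf_inv_image wf_lex_prod wf_less_than wf_lex_less)
next
  fix t s
  assume t: "t \<notin> \<O>" and s: "s \<in> supp (mon (cone_mult t) 1 * N (cone_head t))"
  obtain \<sigma> where "\<sigma> \<in> \<O>" "s = cone_mult t + \<sigma>"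
    using s supp_mon_mult_subset tail_supp[of "cone_head t"] cone_decomp(1)[OF t] P_subset_border
    by blast
  then show "(s, t) \<in> inv_image (less_than <*lex*> {(s, t). lex_less s t})
    (\<lambda>t. (if t \<in> \<O> then 0 else 1 :: nat, cone_mult t))"
    using t cone_mult_less[of \<sigma> "cone_mult t"] by (simp add: inv_image_def)
qed

declare nf.simps [simp del]

lemma nf_order_ideal: "\<sigma> \<in> \<O> \<Longrightarrow> nf \<sigma> = mon \<sigma> 1"
  by (simp add: nf.simps)

lemma nf_cone:
  assumes "\<alpha> \<in> P" "\<eta> \<in> pommaret_mult \<alpha>"
  shows "nf (\<eta> + \<alpha>) = lin_ext nf (mon \<eta> 1 * N \<alpha>)"
proof -
  have "\<eta> + \<alpha> \<notin> \<O>"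
    using assms(1) factor_in(2) by (auto simp: P_def)
  then show ?thesis
    by (subst nf.simps) (simp add: cone_mult_eq[OF assms])
qed

definition L :: "('x, 'a) mpoly \<Rightarrow> ('x, 'a) mpoly" where
  "L = lin_ext nf"

lemma L_mult:
  assumes "\<alpha> \<in> P" "\<eta> \<in> pommaret_mult \<alpha>"
  shows "L (mon \<eta> c * b \<alpha>) = 0"
proof -
  have "mon \<eta> c * N \<alpha> = mon 0 c * (mon \<eta> 1 * N \<alpha>)"
    by (simp add: mult.assoc[symmetric] mult_single)
  then show ?thesis
    by (simp add: L_def mon_mult_b lin_ext_diff lin_ext_mon nf_cone[OF assms] lin_ext_scale)
qed

lemma L_fixed: "supp g \<subseteq> \<O> \<Longrightarrow> L g = g"
  unfolding L_def by (rule lin_ext_fixed) (auto simp: nf_order_ideal)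

lemma nf_pommaret: "\<alpha> \<in> P \<Longrightarrow> nf \<alpha> = N \<alpha>"
  using nf_cone[of \<alpha> 0] L_fixed[OF tail_supp, of \<alpha>] P_subset_border
  by (auto simp: pommaret_mult_def L_def)

lemma supp_nf: "supp (nf t) \<subseteq> \<O>"
proof (induction t rule: nf.induct)
  case (1 t)
  show ?case
  proof (cases "t \<in> \<O>")
    case False
    with 1 have "supp (lin_ext nf (mon (cone_mult t) 1 * N (cone_head t))) \<subseteq> \<O>"
      by (intro supp_lin_ext)
    with False show ?thesis
      by (subst nf.simps) simp
  qed (simp add: nf_order_ideal)
qed

lemma coeffs_nf:
  assumes "coeff_ideal S I" and N: "\<And>\<alpha>. \<alpha> \<in> P \<Longrightarrow> coeffs_in S (N \<alpha>)"
  shows "coeffs_in S (nf t)"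
proof -
  interpret coeff_ideal S I by fact
  show ?thesis
  proof (induction t rule: nf.induct)
    case (1 t)
    show ?case
    proof (cases "t \<in> \<O>")
      case False
      have "coeffs_in S (mon (cone_mult t) 1 * N (cone_head t))"
        by (intro coeffs_ring_mult) (simp_all add: one_in N cone_decomp[OF False])
      with 1 False have "coeffs_in S (lin_ext nf (mon (cone_mult t) 1 * N (cone_head t)))"
        by (intro coeffs_ring_lin_ext)
      with False show ?thesis
        by (subst nf.simps) simp
    qed (simp add: nf_order_ideal one_in)
  qed
qed

definition pommaret_marked :: "('x, 'a) marked set" where
  "pommaret_marked = {(\<alpha>, b \<alpha>) | \<alpha>. \<alpha> \<in> P}"

lemma red_step_pommaret_L:
  assumes "red_step pommaret_marked pommaret_mult g h"
  shows "L h = L g"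
  using assms L_mult by (auto simp: red_step_def pommaret_marked_def L_def lin_ext_diff)

lemma rtranclp_pommaret_L:
  "(red_step pommaret_marked pommaret_mult)\<^sup>*\<^sup>* g h \<Longrightarrow> L h = L g"
  by (induction rule: rtranclp_induct) (auto dest: red_step_pommaret_L)

text \<open>
  A step removes one term and adds only terms that lie in \<open>\<O>\<close> or have smaller multipliers,
  so the multiset of the multipliers of the terms outside \<open>\<O>\<close> decreases.
\<close>

lemma pommaret_step_decreases:
  assumes t: "t \<in> supp g - \<O>"
  defines "M \<equiv> \<lambda>g :: ('x, 'a) mpoly. image_mset cone_mult (mset_set (supp g - \<O>))"
  shows "\<exists>h. red_step pommaret_marked pommaret_mult g h \<and>
    (M h, M g) \<in> mult {(s, t). lex_less s t}"
proof -
  define \<eta> \<alpha> where "\<eta> = cone_mult t" and "\<alpha> = cone_head t"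
  have dec: "\<alpha> \<in> P" "\<eta> \<in> pommaret_mult \<alpha>" "\<eta> + \<alpha> = t"
    using cone_decomp[of t] t by (simp_all add: \<eta>_def \<alpha>_def)
  define r where "r = mon \<eta> (coef g t) * N \<alpha>"
  define h where "h = g - mon \<eta> (coef g t) * b \<alpha>"
  have step: "red_step pommaret_marked pommaret_mult g h"
    unfolding red_step_def pommaret_marked_def h_def using dec t by force
  have h: "h = g - mon t (coef g t) + r"
    using dec(3) by (simp add: h_def mon_mult_b r_def)
  have r: "s \<in> {\<eta> + \<sigma> | \<sigma>. \<sigma> \<in> \<O>}" if "s \<in> supp r" for s
    using that supp_mon_mult_subset[of \<eta> "coef g t" "N \<alpha>"] tail_supp[of \<alpha>] dec(1) P_subset_border
    unfolding r_def by blast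
  have "t \<notin> supp r"
    using r[of t] dec(1,3) by (auto simp: P_def)
  then have t_h: "t \<notin> supp h"
    by (simp add: h in_keys_iff lookup_add lookup_minus)
  define A B where "A = supp g - \<O>" and "B = supp h - \<O>"
  have fin: "finite A" "finite B" by (simp_all add: A_def B_def)
  have new: "lex_less (cone_mult s) (cone_mult t)" if "s \<in> B - A" for s
  proof -
    from that have "s \<notin> \<O>" "s \<in> supp h" "s \<notin> supp g"
      by (auto simp: A_def B_def)
    then have "s \<in> supp r"
      using t by (auto simp: h in_keys_iff lookup_add lookup_minus lookup_single when_def split: if_splits)
    then show ?thesis
      using r \<open>s \<notin> \<O>\<close> cone_mult_less unfolding \<eta>_def by blast
  qed
  have "A \<inter> B \<union> (B - A) = B" "A \<inter> B \<union> (A - B) = A"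
    by blast+
  then have "mset_set B = mset_set (A \<inter> B) + mset_set (B - A)"
    "mset_set A = mset_set (A \<inter> B) + mset_set (A - B)"
    using mset_set_Union[of "A \<inter> B" "B - A"] mset_set_Union[of "A \<inter> B" "A - B"] fin by auto
  moreover have "t \<in> A - B"
    using t t_h by (simp add: A_def B_def)
  ultimately have "(M h, M g) \<in> mult {(s, t). lex_less s t}"
    unfolding M_def A_def[symmetric] B_def[symmetric]
    using new fin by (auto intro!: one_step_implies_mult bexI[of _ "cone_mult t"] simp: mset_set_empty_iff)
  with step show ?thesis by blast
qed

text \<open>
  Every reduction step preserves \<open>L\<close>, and \<open>L\<close> fixes the reduced polynomials. So termination is
  enough: wherever a reduction ends, it ends in \<open>L g\<close>.
\<close>

lemma pommaret_reduces_to_L: "reduces_to pommaret_marked pommaret_mult \<O> g (L g)"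
proof -
  let ?M = "\<lambda>g :: ('x, 'a) mpoly. image_mset cone_mult (mset_set (supp g - \<O>))"
  have "\<exists>h. reduces_to pommaret_marked pommaret_mult \<O> g h" for g
  proof (induction g rule: wf_induct[OF wf_inv_image[OF wf_mult[OF wf_lex_less]], of ?M])
    case (1 g)
    show ?case
    proof (cases "supp g \<subseteq> \<O>")
      case True
      then show ?thesis by (auto simp: reduces_to_def)
    next
      case False
      then obtain t where "t \<in> supp g - \<O>" by blast
      from pommaret_step_decreases[OF this] obtain g' where
        g': "red_step pommaret_marked pommaret_mult g g'"
        "(?M g', ?M g) \<in> mult {(s, t). lex_less s t}" by blast
      with 1 obtain h where "reduces_to pommaret_marked pommaret_mult \<O> g' h"
        unfolding in_inv_image by blast
      with g'(1) show ?thesis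
        unfolding reduces_to_def by (meson converse_rtranclp_into_rtranclp)
    qed
  qed
  then obtain h where h: "reduces_to pommaret_marked pommaret_mult \<O> g h" by blast
  then have "h = L g"
    using rtranclp_pommaret_L[of g h] L_fixed[of h] by (simp add: reduces_to_def)
  with h show ?thesis by simp
qed

text \<open>
  The S-polynomial of a nonmultiplicative couple is \<open>x b \<alpha> - \<eta> b \<alpha>'\<close> with \<open>\<eta>\<close> multiplicative for
  \<open>\<alpha>'\<close>, and \<open>L\<close> kills the second summand. Every nonmultiplicative \<open>x\<close> arises in this way.
\<close>

lemma L_spoly:
  assumes \<alpha>: "\<alpha> \<in> P" and x: "Var x \<notin> pommaret_mult \<alpha>"
  defines "\<alpha>' \<equiv> cone_head (Var x + \<alpha>)"
  shows "nonmult_couple \<alpha> \<alpha>'" "\<alpha>' \<in> P"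
    "L (spoly (\<alpha>, b \<alpha>) (\<alpha>', b \<alpha>')) = L (mon (Var x) 1 * b \<alpha>)"
proof -
  define \<eta> where "\<eta> = cone_mult (Var x + \<alpha>)"
  note nm = nonmult_cone[OF \<alpha> x]
  have dec: "\<alpha>' \<in> P" "\<eta> \<in> pommaret_mult \<alpha>'" "\<eta> + \<alpha>' = Var x + \<alpha>"
    using cone_decomp[OF nm(1)] by (simp_all add: \<eta>_def \<alpha>'_def)
  show "\<alpha>' \<in> P" by fact
  show "nonmult_couple \<alpha> \<alpha>'"
    unfolding nonmult_couple_def cone_def using x dec by (metis (mono_tags, lifting) mem_Collect_eq)
  have le: "coef \<alpha>' y \<le> coef (Var x) y + coef \<alpha> y" for y
    using arg_cong[OF dec(3), of "\<lambda>t. coef t y"] by (simp add: lookup_add)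
  have "\<exists>y. coef \<alpha>' y > coef \<alpha> y"
    using nm(3) by (auto simp: \<alpha>'_def trm_dvd_iff not_le)
  then have "coef \<alpha>' x > coef \<alpha> x"
    using le by (metis add_0 leD lookup_single_not_eq)
  have "\<alpha>' - \<alpha> = Var x"
  proof (rule poly_mapping_eqI)
    fix y
    show "coef (\<alpha>' - \<alpha>) y = coef (Var x) y"
      using le[of y] \<open>coef \<alpha>' x > coef \<alpha> x\<close>
      by (cases "y = x") (auto simp: lookup_minus lookup_single when_def)
  qed
  then have "trm_lcm \<alpha> \<alpha>' = Var x + \<alpha>"
    by (simp add: trm_lcm_def add.commute)
  moreover have "Var x + \<alpha> - \<alpha>' = \<eta>"
    using dec(3) by (metis add_diff_cancel_right')
  ultimately have "spoly (\<alpha>, b \<alpha>) (\<alpha>', b \<alpha>') = mon (Var x) 1 * b \<alpha> - mon \<eta> 1 * b \<alpha>'"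
    by (simp add: spoly_def)
  then show "L (spoly (\<alpha>, b \<alpha>) (\<alpha>', b \<alpha>')) = L (mon (Var x) 1 * b \<alpha>)"
    using L_mult[OF dec(1,2), of 1] by (simp add: L_def lin_ext_diff)
qed

end

section \<open>Normal form maps modulo an ideal\<close>

locale marked_mod = marked_border \<O> N + coeff_ideal S I
  for \<O> :: "'x::{finite,linorder} trm set" and N :: "'x trm \<Rightarrow> ('x, 'a::comm_ring_1) mpoly"
    and S I :: "'a set" +
  assumes tail_coeffs: "\<tau> \<in> border \<O> \<Longrightarrow> coeffs_in S (N \<tau>)"
begin

lemma coeffs_pommaret_tail: "\<alpha> \<in> P \<Longrightarrow> coeffs_in S (N \<alpha>)"
  using tail_coeffs P_subset_border by blast

lemma coeffs_b: "\<tau> \<in> border \<O> \<Longrightarrow> coeffs_in S (b \<tau>)"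
  unfolding b_def by (intro coeffs_ring_diff tail_coeffs) (simp_all add: one_in)

lemma coeffs_mon_mult_b: "\<tau> \<in> border \<O> \<Longrightarrow> c \<in> S \<Longrightarrow> coeffs_in S (mon \<eta> c * b \<tau>)"
  by (intro coeffs_ring_mult coeffs_b) simp_all

lemma coeffs_spoly:
  "\<tau> \<in> border \<O> \<Longrightarrow> \<tau>' \<in> border \<O> \<Longrightarrow> coeffs_in S (spoly (\<tau>, b \<tau>) (\<tau>', b \<tau>'))"
  unfolding spoly_def by (intro coeffs_ring_diff) (auto intro: coeffs_mon_mult_b one_in)

text \<open>
  \<open>f\<close> holds the values on terms of a linear map from polynomials to polynomials.
\<close>

definition normal_form_map :: "('x trm \<Rightarrow> ('x, 'a) mpoly) \<Rightarrow> bool" where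
  "normal_form_map f \<longleftrightarrow>
    (\<forall>t. coeffs_in S (f t)) \<and>
    (\<forall>\<sigma>\<in>\<O>. f \<sigma> \<approx> mon \<sigma> 1) \<and>
    (\<forall>\<tau>\<in>border \<O>. \<forall>\<eta>. lin_ext f (mon \<eta> 1 * b \<tau>) \<approx> 0)"

lemma normal_form_map_fixed:
  assumes "normal_form_map f" "supp g \<subseteq> \<O>" "coeffs_in S g"
  shows "lin_ext f g \<approx> g"
  using lin_ext_cong_mod[of g f "\<lambda>t. mon t 1"] assms
  by (auto simp: normal_form_map_def lin_ext_id)

text \<open>
  A normal form map kills all multiples of the marked polynomials, so the lemma covers the border and
  the Pommaret structure at once.
\<close>

lemma red_step_mod:
  assumes f: "normal_form_map f" and M: "M \<subseteq> {(\<tau>, b \<tau>) | \<tau>. \<tau> \<in> border \<O>}"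
    and g: "coeffs_in S g" and step: "red_step M T g h"
  shows "coeffs_in S h \<and> lin_ext f h \<approx> lin_ext f g"
proof -
  from step M obtain \<tau> \<eta> where \<tau>: "\<tau> \<in> border \<O>"
    and h: "h = g - mon \<eta> (coef g (\<eta> + \<tau>)) * b \<tau>"
    unfolding red_step_def by blast
  define c where "c = coef g (\<eta> + \<tau>)"
  have c: "c \<in> S" using g by (simp add: c_def coeffs_in_def)
  have "mon \<eta> c * b \<tau> = mon 0 c * (mon \<eta> 1 * b \<tau>)"
    by (simp add: mult.assoc[symmetric] mult_single)
  then have "lin_ext f (mon \<eta> c * b \<tau>) = mon 0 c * lin_ext f (mon \<eta> 1 * b \<tau>)"
    by (simp add: lin_ext_scale)
  also have "\<dots> \<approx> 0"
    using cong_scale[OF c, of "lin_ext f (mon \<eta> 1 * b \<tau>)" 0] f \<tau> by (simp add: normal_form_map_def)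
  finally have "lin_ext f h \<approx> lin_ext f g"
    using cong_diff[OF cong_refl[of "lin_ext f g"]] by (fastforce simp: h c_def[symmetric] lin_ext_diff)
  then show ?thesis
    using g \<tau> c by (auto simp: h c_def[symmetric] intro!: coeffs_ring_diff coeffs_mon_mult_b)
qed

lemma reduces_to_mod:
  assumes f: "normal_form_map f" and M: "M \<subseteq> {(\<tau>, b \<tau>) | \<tau>. \<tau> \<in> border \<O>}"
    and g: "coeffs_in S g" and red: "reduces_to M T \<O> g h"
  shows "h \<approx> lin_ext f g"
proof -
  from red have steps: "(red_step M T)\<^sup>*\<^sup>* g h" and h: "supp h \<subseteq> \<O>"
    by (auto simp: reduces_to_def)
  from steps have "coeffs_in S h \<and> lin_ext f h \<approx> lin_ext f g"
  proof (induction rule: rtranclp_induct)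
    case base
    then show ?case using g by simp
  next
    case (step y z)
    then show ?case using red_step_mod[OF f M] cong_trans by blast
  qed
  then show ?thesis
    using normal_form_map_fixed[OF f h] cong_sym cong_trans by blast
qed

lemma reduced_spoly_in_ideal:
  assumes f: "normal_form_map f" and M: "M \<subseteq> {(\<tau>, b \<tau>) | \<tau>. \<tau> \<in> border \<O>}"
    and \<tau>: "\<tau> \<in> border \<O>" "\<tau>' \<in> border \<O>"
    and red: "reduces_to M T \<O> (spoly (\<tau>, b \<tau>) (\<tau>', b \<tau>')) h"
  shows "coeffs_in I h"
proof -
  have "lin_ext f (spoly (\<tau>, b \<tau>) (\<tau>', b \<tau>')) \<approx> 0 - 0"
    unfolding spoly_def lin_ext_diff
    by (rule cong_diff) (use f \<tau> in \<open>auto simp: normal_form_map_def\<close>)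
  then have "h \<approx> 0"
    using reduces_to_mod[OF f M coeffs_spoly[OF \<tau>] red] cong_trans by auto
  then show ?thesis by (simp add: cong_0_iff)
qed

lemma tail_cong_nf:
  assumes f: "normal_form_map f" and \<tau>: "\<tau> \<in> border \<O>"
  shows "N \<tau> \<approx> nf \<tau>"
proof -
  have "pommaret_marked \<subseteq> {(\<tau>, b \<tau>) | \<tau>. \<tau> \<in> border \<O>}"
    using P_subset_border by (auto simp: pommaret_marked_def)
  then have "nf \<tau> \<approx> f \<tau>"
    using reduces_to_mod[OF f _ _ pommaret_reduces_to_L[of "mon \<tau> 1"]]
    by (simp add: one_in L_def lin_ext_mon)
  also have "lin_ext f (mon 0 1 * b \<tau>) \<approx> 0"
    using f \<tau> unfolding normal_form_map_def by blast
  then have "f \<tau> \<approx> lin_ext f (N \<tau>)"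
    by (simp add: b_def lin_ext_diff lin_ext_mon cong_diff_0_iff)
  also have "\<dots> \<approx> N \<tau>"
    using normal_form_map_fixed[OF f tail_supp tail_coeffs] \<tau> by blast
  finally show ?thesis by (rule cong_sym)
qed

end


declare One_nat_def [simp del] \<comment> \<open>keeps \<open>Var x\<close> in the form in which facts about it are stated\<close>

section \<open>Pommaret normal forms when the nonmultiplicative couples reduce to zero\<close>

context marked_mod
begin

text \<open>
  Normal forms are compatible with multiplication by \<open>\<eta>\<close>, as far as the multiples of the marked
  polynomials that occur in computing \<open>nf t\<close>, once multiplied by \<open>\<eta>\<close>, have normal form 0. The
  bound \<open>e\<close> confines this hypothesis to small multipliers, as needed for the induction in
  \<open>L_pommaret_multiple\<close>.
\<close>

lemma nf_shift:
  assumes good: "\<And>\<alpha> \<eta>'. \<alpha> \<in> P \<Longrightarrow> lex_less \<eta>' e \<Longrightarrow> L (mon (\<eta> + \<eta>') 1 * b \<alpha>) \<approx> 0"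
  shows "t \<in> \<O> \<or> lex_less (cone_mult t) e \<Longrightarrow> nf (\<eta> + t) \<approx> lin_ext (\<lambda>s. nf (\<eta> + s)) (nf t)"
proof (induction t rule: nf.induct)
  case (1 t)
  show ?case
  proof (cases "t \<in> \<O>")
    case True
    then show ?thesis by (simp add: nf_order_ideal lin_ext_mon)
  next
    case False
    define \<mu> \<alpha> where "\<mu> = cone_mult t" and "\<alpha> = cone_head t"
    have dec: "\<alpha> \<in> P" "\<mu> \<in> pommaret_mult \<alpha>" "\<mu> + \<alpha> = t"
      using cone_decomp[OF False] by (simp_all add: \<mu>_def \<alpha>_def)
    have \<mu>: "lex_less \<mu> e"
      using 1(2) False by (simp add: \<mu>_def)
    define g where "g = mon \<mu> 1 * N \<alpha>"
    have g: "coeffs_in S g"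
      unfolding g_def by (intro coeffs_ring_mult coeffs_pommaret_tail dec) (simp add: one_in)
    have "lin_ext (\<lambda>s. nf (\<eta> + s)) g \<approx> lin_ext (\<lambda>s. lin_ext (\<lambda>s. nf (\<eta> + s)) (nf s)) g"
    proof (rule lin_ext_cong_mod[OF g])
      fix s assume s: "s \<in> supp g"
      then obtain \<sigma> where "\<sigma> \<in> \<O>" "s = \<mu> + \<sigma>"
        using supp_mon_mult_subset tail_supp[of \<alpha>] dec(1) P_subset_border
        unfolding g_def by blast
      then have "s \<in> \<O> \<or> lex_less (cone_mult s) e"
        using cone_mult_less[of \<sigma> \<mu>] lex_less_trans[OF _ \<mu>] by blast
      with 1(1)[OF False] s show "nf (\<eta> + s) \<approx> lin_ext (\<lambda>s. nf (\<eta> + s)) (nf s)"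
        by (simp add: g_def \<mu>_def \<alpha>_def)
    qed
    also have "\<dots> = lin_ext (\<lambda>s. nf (\<eta> + s)) (nf t)"
      using nf_cone[OF dec(1,2)] by (simp add: dec(3) lin_ext_lin_ext g_def)
    finally have rec: "lin_ext (\<lambda>s. nf (\<eta> + s)) g \<approx> \<dots>" .
    have "mon (\<eta> + \<mu>) 1 * N \<alpha> = mon \<eta> 1 * g"
      by (simp add: g_def mult.assoc[symmetric] mult_single)
    then have "L (mon (\<eta> + \<mu>) 1 * b \<alpha>) = nf (\<eta> + t) - lin_ext (\<lambda>s. nf (\<eta> + s)) g"
      using dec(3) by (simp add: L_def mon_mult_b lin_ext_diff lin_ext_mon lin_ext_compose_mon_mult add.assoc)
    with good[OF dec(1) \<mu>] have "nf (\<eta> + t) \<approx> lin_ext (\<lambda>s. nf (\<eta> + s)) g"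
      by (simp add: cong_diff_0_iff)
    then show ?thesis
      using rec by (rule cong_trans)
  qed
qed

text \<open>
  Let \<open>\<eta> = \<eta>' x\<close> with \<open>x\<close> nonmultiplicative for \<open>\<alpha>\<close>. All terms of \<open>x b \<alpha>\<close> outside \<open>\<O>\<close> have
  multipliers below \<open>x\<close>. By induction \<open>nf_shift\<close> applies to them with multiplication by \<open>\<eta>'\<close>, so
  the normal form of \<open>\<eta>' x b \<alpha>\<close> is that of \<open>\<eta>' L (x b \<alpha>)\<close>, and \<open>L (x b \<alpha>)\<close> is 0.
\<close>

lemma L_pommaret_multiple:
  assumes nonmult: "\<And>\<alpha> x. \<alpha> \<in> P \<Longrightarrow> Var x \<notin> pommaret_mult \<alpha> \<Longrightarrow> L (mon (Var x) 1 * b \<alpha>) \<approx> 0"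
  shows "\<alpha> \<in> P \<Longrightarrow> L (mon \<eta> 1 * b \<alpha>) \<approx> 0"
proof (induction \<eta> arbitrary: \<alpha> rule: wf_induct_rule[OF wf_lex_less])
  case (1 \<eta> \<alpha>)
  show ?case
  proof (cases "\<eta> \<in> pommaret_mult \<alpha>")
    case True
    then show ?thesis using L_mult[OF 1(2)] by simp
  next
    case False
    then obtain x where x: "x \<in> supp \<eta>" "Var x \<notin> pommaret_mult \<alpha>"
      by (auto simp: pommaret_mult_def)
    define \<eta>' where "\<eta>' = \<eta> - Var x"
    have \<eta>: "\<eta> = \<eta>' + Var x"
      using Var_add_minus[OF x(1)] by (simp add: \<eta>'_def add.commute)
    define q where "q = mon (Var x) 1 * b \<alpha>"
    have q: "coeffs_in S q"
      unfolding q_def using 1(2) P_subset_border by (intro coeffs_mon_mult_b one_in) blast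
    have "L (mon \<eta> 1 * b \<alpha>) = lin_ext (\<lambda>t. nf (\<eta>' + t)) q"
      by (simp add: L_def lin_ext_compose_mon_mult q_def \<eta> mult.assoc[symmetric] mult_single)
    also have "\<dots> \<approx> lin_ext (\<lambda>t. lin_ext (\<lambda>s. nf (\<eta>' + s)) (nf t)) q"
    proof (rule lin_ext_cong_mod[OF q])
      fix t assume "t \<in> supp q"
      moreover have "supp (N \<alpha>) \<subseteq> \<O>"
        using tail_supp 1(2) P_subset_border by blast
      moreover have "supp (mon (Var x + \<alpha>) (1 :: 'a)) \<subseteq> {Var x + \<alpha>}"
        by simp
      ultimately have "t = Var x + \<alpha> \<or> (\<exists>\<sigma>\<in>\<O>. t = Var x + \<sigma>)"
        using supp_diff_subset[of "mon (Var x + \<alpha>) 1" "mon (Var x) 1 * N \<alpha>"]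
          supp_mon_mult_subset[of "Var x" 1 "N \<alpha>"]
        unfolding q_def mon_mult_b by blast
      then have t: "t \<in> \<O> \<or> lex_less (cone_mult t) (Var x)"
        using nonmult_cone(2)[OF 1(2) x(2)] cone_mult_less by blast
      show "nf (\<eta>' + t) \<approx> lin_ext (\<lambda>s. nf (\<eta>' + s)) (nf t)"
      proof (rule nf_shift[OF _ t])
        fix \<alpha>' \<mu> assume "\<alpha>' \<in> P" "lex_less \<mu> (Var x)"
        then show "L (mon (\<eta>' + \<mu>) 1 * b \<alpha>') \<approx> 0"
          using 1(1)[of "\<eta>' + \<mu>" \<alpha>'] lex_less_add_left[of \<mu> "Var x" \<eta>'] by (simp add: \<eta>)
      qed
    qed
    also have "\<dots> = lin_ext (\<lambda>s. nf (\<eta>' + s)) (L q)"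
      by (simp add: L_def lin_ext_lin_ext)
    also have "\<dots> \<approx> lin_ext (\<lambda>s. nf (\<eta>' + s)) 0"
      using nonmult[OF 1(2) x(2)] coeffs_nf[OF coeff_ideal_axioms coeffs_pommaret_tail]
      unfolding q_def by (rule lin_ext_cong_arg)
    finally show ?thesis by simp
  qed
qed

lemma nf_normal_form_map:
  assumes nonmult: "\<And>\<alpha> x. \<alpha> \<in> P \<Longrightarrow> Var x \<notin> pommaret_mult \<alpha> \<Longrightarrow> L (mon (Var x) 1 * b \<alpha>) \<approx> 0"
    and tails: "\<And>\<tau>. \<tau> \<in> border \<O> \<Longrightarrow> N \<tau> \<approx> nf \<tau>"
  shows "normal_form_map nf"
  unfolding normal_form_map_def
proof (intro conjI allI ballI)
  show nf: "coeffs_in S (nf t)" for t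
    by (rule coeffs_nf[OF coeff_ideal_axioms coeffs_pommaret_tail])
  show "nf \<sigma> \<approx> mon \<sigma> 1" if "\<sigma> \<in> \<O>" for \<sigma>
    using that by (simp add: nf_order_ideal)
  fix \<tau> \<eta> assume \<tau>: "\<tau> \<in> border \<O>"
  \<comment> \<open>any term above \<open>cone_mult \<tau>\<close> serves as the bound in \<open>nf_shift\<close>\<close>
  have "lex_less (cone_mult \<tau>) (Var undefined + cone_mult \<tau>)"
    by (auto simp: lex_less_def lookup_add lookup_single when_def intro!: exI[of _ undefined])
  then have "nf (\<eta> + \<tau>) \<approx> lin_ext (\<lambda>s. nf (\<eta> + s)) (nf \<tau>)"
    by (intro nf_shift[OF L_pommaret_multiple[OF nonmult]]) auto
  moreover have "lin_ext (\<lambda>s. nf (\<eta> + s)) (N \<tau>) \<approx> lin_ext (\<lambda>s. nf (\<eta> + s)) (nf \<tau>)"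
    by (rule lin_ext_cong_arg[OF tails[OF \<tau>] nf])
  ultimately have "nf (\<eta> + \<tau>) - lin_ext (\<lambda>s. nf (\<eta> + s)) (N \<tau>) \<approx> 0"
    using cong_diff_0_iff cong_sym cong_trans by blast
  then show "lin_ext nf (mon \<eta> 1 * b \<tau>) \<approx> 0"
    by (simp add: mon_mult_b lin_ext_diff lin_ext_mon lin_ext_compose_mon_mult)
qed

end

section \<open>Formal multiplication operators and the border structure\<close>

context marked_border
begin

text \<open>
  One step of border reduction. It is applied only to terms of \<open>\<O>\<close> and of the border; the default
  value 0 keeps the images inside the span of \<open>\<O>\<close> elsewhere.
\<close>

definition border_nf :: "'x trm \<Rightarrow> ('x, 'a) mpoly" where
  "border_nf t = (if t \<in> \<O> then mon t 1 else if t \<in> border \<O> then N t else 0)"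

definition mult_op :: "'x \<Rightarrow> ('x, 'a) mpoly \<Rightarrow> ('x, 'a) mpoly" where
  "mult_op x = lin_ext (\<lambda>t. border_nf (Var x + t))"

lemma border_nf_order_ideal: "\<sigma> \<in> \<O> \<Longrightarrow> border_nf \<sigma> = mon \<sigma> 1"
  by (simp add: border_nf_def)

lemma border_nf_border: "\<tau> \<in> border \<O> \<Longrightarrow> border_nf \<tau> = N \<tau>"
  by (simp add: border_nf_def border_def)

lemma Var_add_cases: "\<sigma> \<in> \<O> \<Longrightarrow> Var x + \<sigma> \<in> \<O> \<or> Var x + \<sigma> \<in> border \<O>"
  by (auto simp: border_def)

lemma supp_border_nf: "supp (border_nf t) \<subseteq> \<O>"
  using tail_supp by (auto simp: border_nf_def)

lemma border_nf_fixed: "supp g \<subseteq> \<O> \<Longrightarrow> lin_ext border_nf g = g"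
  by (rule lin_ext_fixed) (auto simp: border_nf_order_ideal)

lemma supp_mult_op: "supp (mult_op x g) \<subseteq> \<O>"
  unfolding mult_op_def by (intro supp_lin_ext supp_border_nf)

lemma mult_op_mon [simp]: "mult_op x (mon t 1) = border_nf (Var x + t)"
  by (simp add: mult_op_def lin_ext_mon)

text \<open>
  A polynomial supported on \<open>\<O>\<close> and its border is reduced by using each marked polynomial with
  multiplier 1, since the tails are supported on \<open>\<O>\<close>. S-polynomials of neighbour couples are of
  this kind.
\<close>

lemma border_reduces_to_border_nf:
  assumes T: "\<And>\<tau>. \<tau> \<in> border \<O> \<Longrightarrow> 0 \<in> T \<tau>"
  shows "supp g \<subseteq> \<O> \<union> border \<O> \<Longrightarrow>
    reduces_to {(\<tau>, b \<tau>) | \<tau>. \<tau> \<in> border \<O>} T \<O> g (lin_ext border_nf g)"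
proof (induction "card (supp g - \<O>)" arbitrary: g rule: less_induct)
  case less
  show ?case
  proof (cases "supp g \<subseteq> \<O>")
    case True
    then show ?thesis by (simp add: reduces_to_def border_nf_fixed)
  next
    case False
    with less.prems obtain \<tau> where \<tau>: "\<tau> \<in> supp g" "\<tau> \<in> border \<O>" "\<tau> \<notin> \<O>"
      by blast
    define h where "h = g - mon 0 (coef g \<tau>) * b \<tau>"
    have step: "red_step {(\<tau>, b \<tau>) | \<tau>. \<tau> \<in> border \<O>} T g h"
      unfolding red_step_def h_def using \<tau> T by force
    have tail: "supp (mon 0 (coef g \<tau>) * N \<tau>) \<subseteq> \<O>"
      using supp_mon_mult_subset[of 0 "coef g \<tau>" "N \<tau>"] tail_supp[OF \<tau>(2)] by auto
    have h: "h = g - mon \<tau> (coef g \<tau>) + mon 0 (coef g \<tau>) * N \<tau>"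
      by (simp add: h_def mon_mult_b)
    have coef_h: "coef h s = coef g s - (if s = \<tau> then coef g \<tau> else 0)" if "s \<notin> \<O>" for s
      using that tail by (auto simp: h lookup_add lookup_minus lookup_single when_def in_keys_iff)
    have "supp h - \<O> \<subseteq> supp g - \<O> - {\<tau>}"
      by (auto simp: in_keys_iff coef_h split: if_splits)
    then have "card (supp h - \<O>) < card (supp g - \<O>)" and supp_h: "supp h \<subseteq> \<O> \<union> border \<O>"
      using \<tau> less.prems by (auto intro!: psubset_card_mono)
    then have red: "reduces_to {(\<tau>, b \<tau>) | \<tau>. \<tau> \<in> border \<O>} T \<O> h (lin_ext border_nf h)"
      by (rule less.hyps)
    have "lin_ext border_nf (mon 0 (coef g \<tau>) * b \<tau>) = 0"
      unfolding lin_ext_scale b_def lin_ext_diff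
      by (simp add: lin_ext_mon border_nf_border[OF \<tau>(2)] border_nf_fixed[OF tail_supp[OF \<tau>(2)]])
    then have "lin_ext border_nf h = lin_ext border_nf g"
      by (simp add: h_def lin_ext_diff)
    with red converse_rtranclp_into_rtranclp[of "red_step {(\<tau>, b \<tau>) | \<tau>. \<tau> \<in> border \<O>} T", OF step]
    show ?thesis
      by (simp add: reduces_to_def)
  qed
qed

lemma mult_op_tail: "mult_op x (N \<tau>) = lin_ext border_nf (mon (Var x) 1 * N \<tau>)"
  by (simp add: mult_op_def lin_ext_compose_mon_mult)

lemma supp_Var_mult_tail:
  "\<tau> \<in> border \<O> \<Longrightarrow> supp (mon (Var x) 1 * N \<tau>) \<subseteq> \<O> \<union> border \<O>"
  using supp_mon_mult_subset[of "Var x" 1 "N \<tau>"] tail_supp[of \<tau>] Var_add_cases by blast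

lemma spoly_next_door:
  assumes Y: "Y \<in> border \<O>" and Z: "Var x + Y \<in> border \<O>"
  defines "s \<equiv> spoly (Var x + Y, b (Var x + Y)) (Y, b Y)"
  shows "supp s \<subseteq> \<O> \<union> border \<O>" "lin_ext border_nf s = mult_op x (N Y) - N (Var x + Y)"
proof -
  have "trm_lcm (Var x + Y) Y = Var x + Y"
    unfolding trm_lcm_def by (intro poly_mapping_eqI) (simp add: lookup_add lookup_minus)
  then have s: "s = mon (Var x) 1 * N Y - N (Var x + Y)"
    unfolding s_def spoly_def by (simp add: mon_mult_b) (simp add: b_def)
  show "supp s \<subseteq> \<O> \<union> border \<O>"
    using supp_Var_mult_tail[OF Y, of x] tail_supp[OF Z]
      supp_diff_subset[of "mon (Var x) 1 * N Y" "N (Var x + Y)"] unfolding s by blast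
  show "lin_ext border_nf s = mult_op x (N Y) - N (Var x + Y)"
    unfolding s by (simp only: lin_ext_diff mult_op_tail border_nf_fixed[OF tail_supp[OF Z]])
qed

lemma spoly_across_the_street:
  assumes X: "Var x + \<sigma> \<in> border \<O>" and Y: "Var y + \<sigma> \<in> border \<O>" and "x \<noteq> y"
  defines "s \<equiv> spoly (Var x + \<sigma>, b (Var x + \<sigma>)) (Var y + \<sigma>, b (Var y + \<sigma>))"
  shows "supp s \<subseteq> \<O> \<union> border \<O>"
    "lin_ext border_nf s = mult_op x (N (Var y + \<sigma>)) - mult_op y (N (Var x + \<sigma>))"
proof -
  have "(Var y + \<sigma>) - (Var x + \<sigma>) = Var y"
    using \<open>x \<noteq> y\<close> by (intro poly_mapping_eqI) (auto simp: lookup_add lookup_minus lookup_single when_def)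
  then have lcm: "trm_lcm (Var x + \<sigma>) (Var y + \<sigma>) = (Var x + \<sigma>) + Var y"
    unfolding trm_lcm_def by simp
  then have lcm': "trm_lcm (Var x + \<sigma>) (Var y + \<sigma>) = (Var y + \<sigma>) + Var x"
    by (simp add: ac_simps)
  have "s = mon (Var y) 1 * b (Var x + \<sigma>) - mon (Var x) 1 * b (Var y + \<sigma>)"
    unfolding s_def spoly_def fst_conv snd_conv
    by (subst (2) lcm', subst lcm) (simp only: add_diff_cancel_left')
  then have s: "s = mon (Var x) 1 * N (Var y + \<sigma>) - mon (Var y) 1 * N (Var x + \<sigma>)"
    by (simp add: mon_mult_b ac_simps)
  show "supp s \<subseteq> \<O> \<union> border \<O>"
    using supp_Var_mult_tail[OF Y, of x] supp_Var_mult_tail[OF X, of y]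
      supp_diff_subset[of "mon (Var x) 1 * N (Var y + \<sigma>)" "mon (Var y) 1 * N (Var x + \<sigma>)"]
    unfolding s by blast
  show "lin_ext border_nf s = mult_op x (N (Var y + \<sigma>)) - mult_op y (N (Var x + \<sigma>))"
    unfolding s by (simp only: lin_ext_diff mult_op_tail)
qed

text \<open>
  The variables of \<open>t\<close> act on 1, the smallest variable last. An order has to be chosen, since the
  operators commute only modulo an ideal.
\<close>

function op_nf :: "'x trm \<Rightarrow> ('x, 'a) mpoly" where
  "op_nf t = (if t = 0 then mon 0 1 else mult_op (min_var t) (op_nf (t - Var (min_var t))))"
  by pat_completeness auto

termination
proof (relation "measure trm_deg")
  fix t :: "'x trm" assume "t \<noteq> 0"
  then have "t = Var (min_var t) + (t - Var (min_var t))"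
    using Var_add_minus[OF min_var_in] by metis
  then have "trm_deg t = 1 + trm_deg (t - Var (min_var t))"
    by (metis trm_deg_add trm_deg_Var)
  then show "(t - Var (min_var t), t) \<in> measure trm_deg"
    by simp
qed simp

declare op_nf.simps [simp del]

lemma op_nf_min_var: "op_nf (Var x + t) = mult_op x (op_nf t)" if "\<And>y. y \<in> supp t \<Longrightarrow> x \<le> y"
proof -
  have "min_var (Var x + t) = x"
    unfolding min_var_def by (rule Min_eqI) (use that in \<open>auto simp: supp_trm_add\<close>)
  moreover have "Var x + t \<noteq> 0"
    using supp_trm_add[of "Var x" t] by auto
  ultimately show ?thesis
    by (subst op_nf.simps) simp
qed

end

section \<open>Border normal forms when the neighbour couples reduce to zero\<close>

context marked_mod
begin

lemma coeffs_border_nf: "coeffs_in S (border_nf t)"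
  using tail_coeffs one_in by (simp add: border_nf_def)

lemma mult_op_cong: "p \<approx> q \<Longrightarrow> mult_op x p \<approx> mult_op x q"
  unfolding mult_op_def by (rule lin_ext_cong_arg[OF _ coeffs_border_nf])

lemma coeffs_mult_op: "coeffs_in S p \<Longrightarrow> coeffs_in S (mult_op x p)"
  unfolding mult_op_def by (intro coeffs_ring_lin_ext coeffs_border_nf)

lemma coeffs_op_nf: "coeffs_in S (op_nf t) \<and> supp (op_nf t) \<subseteq> \<O>"
proof (induction t rule: op_nf.induct)
  case (1 t)
  show ?case
  proof (cases "t = 0")
    case True
    then show ?thesis
      using one_in zero_in_O coeffs_ring_simps(2)[of 0 1] by (simp add: op_nf.simps)
  next
    case False
    with 1 show ?thesis
      by (subst op_nf.simps, subst (2) op_nf.simps) (simp add: coeffs_mult_op supp_mult_op)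
  qed
qed

text \<open>
  On a term \<open>\<sigma>\<close> of \<open>\<O>\<close> the commutator is 0 unless \<open>x \<sigma>\<close> or \<open>y \<sigma>\<close> is in the border. If
  both are, it is what the S-polynomial of the couple \<open>(x \<sigma>, y \<sigma>)\<close> reduces to; if only
  \<open>y \<sigma>\<close> is, it is what that of the couple \<open>(x y \<sigma>, y \<sigma>)\<close> reduces to.
\<close>

lemma mult_ops_commute:
  assumes neighbours: "\<And>\<tau> \<tau>'. \<tau> \<in> border \<O> \<Longrightarrow> \<tau>' \<in> border \<O> \<Longrightarrow> neighbour \<tau> \<tau>' \<Longrightarrow>
      supp (spoly (\<tau>, b \<tau>) (\<tau>', b \<tau>')) \<subseteq> \<O> \<union> border \<O> \<Longrightarrow>
      lin_ext border_nf (spoly (\<tau>, b \<tau>) (\<tau>', b \<tau>')) \<approx> 0"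
    and g: "supp g \<subseteq> \<O>" "coeffs_in S g"
  shows "mult_op x (mult_op y g) \<approx> mult_op y (mult_op x g)"
proof -
  have next_door: "mult_op y (border_nf (Var x + \<sigma>)) \<approx> mult_op x (border_nf (Var y + \<sigma>))"
    if "\<sigma> \<in> \<O>" "Var x + \<sigma> \<in> \<O>" "Var y + \<sigma> \<in> border \<O>" for \<sigma> x y
  proof -
    have Z: "Var x + (Var y + \<sigma>) = Var y + (Var x + \<sigma>)"
      by (simp add: ac_simps)
    have "Var x + (Var y + \<sigma>) \<notin> \<O>"
      using factor_in(2)[of "Var x" "Var y + \<sigma>"] that(3) by (auto simp: border_def)
    then have border: "Var x + (Var y + \<sigma>) \<in> border \<O>"
      using Var_add_cases[OF that(2), of y] Z by simp
    note s = spoly_next_door[OF that(3) border]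
    have "neighbour (Var x + (Var y + \<sigma>)) (Var y + \<sigma>)"
      unfolding neighbour_def by blast
    from neighbours[OF border that(3) this s(1)]
    have "mult_op x (N (Var y + \<sigma>)) \<approx> N (Var x + (Var y + \<sigma>))"
      unfolding s(2) cong_diff_0_iff .
    moreover have "mult_op y (border_nf (Var x + \<sigma>)) = N (Var x + (Var y + \<sigma>))"
      unfolding border_nf_order_ideal[OF that(2)] mult_op_mon Z[symmetric]
      by (rule border_nf_border[OF border])
    ultimately show ?thesis
      using cong_sym by (simp add: border_nf_border[OF that(3)])
  qed
  have basis: "mult_op x (border_nf (Var y + \<sigma>)) \<approx> mult_op y (border_nf (Var x + \<sigma>))" if \<sigma>: "\<sigma> \<in> \<O>" for \<sigma>
  proof -
    consider "x = y" | "Var x + \<sigma> \<in> \<O>" "Var y + \<sigma> \<in> \<O>" | "Var x + \<sigma> \<in> \<O>" "Var y + \<sigma> \<in> border \<O>"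
      | "Var x + \<sigma> \<in> border \<O>" "Var y + \<sigma> \<in> \<O>"
      | "x \<noteq> y" "Var x + \<sigma> \<in> border \<O>" "Var y + \<sigma> \<in> border \<O>"
      using Var_add_cases[OF \<sigma>] by blast
    then show ?thesis
    proof cases
      case 2
      then show ?thesis by (simp add: border_nf_order_ideal add.left_commute)
    next
      case 3
      then show ?thesis using next_door[OF \<sigma>] cong_sym by blast
    next
      case 4
      then show ?thesis using next_door[OF \<sigma>] by blast
    next
      case 5
      note s = spoly_across_the_street[OF 5(2,3,1)]
      have "Var y + (Var x + \<sigma>) = Var x + (Var y + \<sigma>)"
        by (simp add: ac_simps)
      then have "neighbour (Var x + \<sigma>) (Var y + \<sigma>)"
        unfolding neighbour_def by blast
      from neighbours[OF 5(2,3) this s(1)] show ?thesis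
        unfolding s(2) by (simp add: cong_diff_0_iff border_nf_border 5)
    qed simp
  qed
  have "mult_op x (mult_op y g) = lin_ext (\<lambda>\<sigma>. mult_op x (border_nf (Var y + \<sigma>))) g" for x y
    by (simp add: mult_op_def lin_ext_lin_ext)
  moreover have "lin_ext (\<lambda>\<sigma>. mult_op x (border_nf (Var y + \<sigma>))) g \<approx> lin_ext (\<lambda>\<sigma>. mult_op y (border_nf (Var x + \<sigma>))) g"
    by (rule lin_ext_cong_mod[OF g(2)]) (use basis g(1) in blast)
  ultimately show ?thesis by simp
qed

text \<open>
  The order in which variables act is irrelevant once the operators commute. So the action is
  multiplicative, sends \<open>\<sigma> \<in> \<O>\<close> to \<open>\<sigma>\<close> and a border term to its tail, and hence kills every \<open>b \<tau>\<close>
  and all its multiples.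
\<close>

lemma op_nf_normal_form_map:
  assumes commute: "\<And>g x y. supp g \<subseteq> \<O> \<Longrightarrow> coeffs_in S g \<Longrightarrow>
      mult_op x (mult_op y g) \<approx> mult_op y (mult_op x g)"
  shows "normal_form_map op_nf"
proof -
  have op_nf_Var: "op_nf (Var x + t) \<approx> mult_op x (op_nf t)" for x t
  proof (induction "trm_deg t" arbitrary: t rule: less_induct)
    case less
    show ?case
    proof (cases "\<forall>y\<in>supp t. x \<le> y")
      case True
      then show ?thesis by (simp add: op_nf_min_var)
    next
      case False
      then obtain y where y: "y \<in> supp t" "y < x"
        by auto
      define m t' where "m = min_var t" and "t' = t - Var m"
      have "t \<noteq> 0" using y by auto
      then have m: "m \<in> supp t" "m < x"
        using min_var_in min_var_le[OF y(1)] y(2) by (auto simp: m_def)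
      have t: "t = Var m + t'"
        using Var_add_minus[OF m(1)] by (simp add: t'_def)
      have m_le: "m \<le> z" if "z \<in> supp t'" for z
      proof -
        have "z \<in> supp t"
          using that unfolding t supp_trm_add by blast
        then show ?thesis
          unfolding m_def by (rule min_var_le)
      qed
      have "op_nf (Var x + t) = op_nf (Var m + (Var x + t'))"
        by (simp add: t ac_simps)
      also have "\<dots> = mult_op m (op_nf (Var x + t'))"
        by (rule op_nf_min_var) (use m_le m(2) in \<open>auto simp: supp_trm_add less_imp_le\<close>)
      also have "\<dots> \<approx> mult_op m (mult_op x (op_nf t'))"
        by (intro mult_op_cong less.hyps) (simp add: t trm_deg_add)
      also have "\<dots> \<approx> mult_op x (mult_op m (op_nf t'))"
        using commute coeffs_op_nf by blast
      also have "mult_op m (op_nf t') = op_nf t"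
        using op_nf_min_var[of t' m] m_le by (simp add: t)
      finally show ?thesis .
    qed
  qed
  have op_nf_O: "op_nf \<sigma> \<approx> mon \<sigma> 1" if "\<sigma> \<in> \<O>" for \<sigma>
    using that
  proof (induction \<sigma> rule: op_nf.induct)
    case (1 \<sigma>)
    show ?case
    proof (cases "\<sigma> = 0")
      case True
      then show ?thesis by (simp add: op_nf.simps)
    next
      case False
      let ?m = "min_var \<sigma>"
      have \<sigma>: "Var ?m + (\<sigma> - Var ?m) = \<sigma>"
        by (rule Var_add_minus[OF min_var_in[OF False]])
      then have "\<sigma> - Var ?m \<in> \<O>"
        using factor_in(2) 1(2) by metis
      then have "op_nf (\<sigma> - Var ?m) \<approx> mon (\<sigma> - Var ?m) 1"
        by (rule 1(1)[OF False])
      then have "mult_op ?m (op_nf (\<sigma> - Var ?m)) \<approx> mult_op ?m (mon (\<sigma> - Var ?m) 1)"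
        by (rule mult_op_cong)
      then have "mult_op ?m (op_nf (\<sigma> - Var ?m)) \<approx> mon \<sigma> 1"
        unfolding mult_op_mon \<sigma> border_nf_order_ideal[OF 1(2)] .
      then show ?thesis
        using False by (subst op_nf.simps) simp
    qed
  qed
  have op_nf_border: "op_nf \<tau> \<approx> N \<tau>" if \<tau>: "\<tau> \<in> border \<O>" for \<tau>
  proof -
    from \<tau> obtain x \<sigma> where \<sigma>: "\<sigma> \<in> \<O>" "\<tau> = Var x + \<sigma>"
      by (auto simp: border_def)
    have "op_nf \<tau> \<approx> mult_op x (op_nf \<sigma>)"
      unfolding \<sigma>(2) by (rule op_nf_Var)
    also have "\<dots> \<approx> mult_op x (mon \<sigma> 1)"
      by (rule mult_op_cong[OF op_nf_O[OF \<sigma>(1)]])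
    also have "\<dots> = N \<tau>"
      using border_nf_border[OF \<tau>] \<sigma>(2) by simp
    finally show ?thesis .
  qed
  have op_nf_mult: "lin_ext op_nf (mon (Var x) 1 * p) \<approx> mult_op x (lin_ext op_nf p)"
    if "coeffs_in S p" for x p
  proof -
    have "lin_ext op_nf (mon (Var x) 1 * p) = lin_ext (\<lambda>t. op_nf (Var x + t)) p"
      by (rule lin_ext_compose_mon_mult[symmetric])
    also have "\<dots> \<approx> lin_ext (\<lambda>t. mult_op x (op_nf t)) p"
      by (rule lin_ext_cong_mod[OF that op_nf_Var])
    also have "\<dots> = mult_op x (lin_ext op_nf p)"
      by (simp add: mult_op_def lin_ext_lin_ext)
    finally show ?thesis .
  qed
  have "lin_ext op_nf (mon \<eta> 1 * b \<tau>) \<approx> 0" if \<tau>: "\<tau> \<in> border \<O>" for \<tau> \<eta>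
  proof (induction "trm_deg \<eta>" arbitrary: \<eta> rule: less_induct)
    case less
    show ?case
    proof (cases "\<eta> = 0")
      case True
      have "lin_ext op_nf (N \<tau>) \<approx> lin_ext (\<lambda>t. mon t 1) (N \<tau>)"
        by (rule lin_ext_cong_mod[OF tail_coeffs[OF \<tau>]]) (use op_nf_O tail_supp[OF \<tau>] in blast)
      then have "lin_ext op_nf (N \<tau>) \<approx> N \<tau>"
        by (simp add: lin_ext_id)
      then have "op_nf \<tau> - lin_ext op_nf (N \<tau>) \<approx> N \<tau> - N \<tau>"
        by (rule cong_diff[OF op_nf_border[OF \<tau>]])
      then show ?thesis
        by (simp add: True b_def lin_ext_diff lin_ext_mon)
    next
      case False
      then obtain x where "x \<in> supp \<eta>"
        using min_var_in by blast
      define \<eta>' where "\<eta>' = \<eta> - Var x"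
      have \<eta>: "\<eta> = Var x + \<eta>'"
        using Var_add_minus[OF \<open>x \<in> supp \<eta>\<close>] by (simp add: \<eta>'_def)
      have "mon \<eta> 1 * b \<tau> = mon (Var x) 1 * (mon \<eta>' 1 * b \<tau>)"
        by (simp add: \<eta> mult.assoc[symmetric] mult_single)
      then have "lin_ext op_nf (mon \<eta> 1 * b \<tau>) \<approx> mult_op x (lin_ext op_nf (mon \<eta>' 1 * b \<tau>))"
        using op_nf_mult[OF coeffs_mon_mult_b[OF \<tau> one_in]] by simp
      also have "\<dots> \<approx> mult_op x 0"
        by (intro mult_op_cong less.hyps) (simp add: \<eta> trm_deg_add)
      finally show ?thesis
        by (simp add: mult_op_def)
    qed
  qed
  then show ?thesis
    unfolding normal_form_map_def using coeffs_op_nf op_nf_O by blast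
qed

end


section \<open>Polynomial rings in a set of indeterminates\<close>

lemma indets_0 [simp]: "indets 0 = {}"
  by (simp add: indets_def)

lemma indets_mon: "indets (mon t c) = (if c = 0 then {} else supp t)"
  by (simp add: indets_def)

lemma indets_1 [simp]: "indets (1 :: ('v, 'a::comm_ring_1) mpoly) = {}"
  using indets_mon[of 0 "1 :: 'a"] by simp

lemma indets_add: "indets (p + q) \<subseteq> indets p \<union> indets q"
  using Poly_Mapping.keys_add[of p q] unfolding indets_def by blast

lemma indets_uminus [simp]: "indets (- p) = indets (p :: ('v, 'a::comm_ring_1) mpoly)"
  by (simp add: indets_def in_keys_iff set_eq_iff)

lemma indets_mult: "indets (p * q) \<subseteq> indets p \<union> indets (q :: ('v, 'a::comm_ring_1) mpoly)"
proof
  fix x assume "x \<in> indets (p * q)"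
  then obtain s t where "s \<in> supp p" "t \<in> supp q" "x \<in> supp (s + t)"
    using supp_mult_subset[of p q] unfolding indets_def by blast
  then show "x \<in> indets p \<union> indets q"
    unfolding indets_def supp_trm_add by blast
qed

lemma poly_ring_simps [simp]:
  "carrier (poly_ring V) = {p. indets p \<subseteq> V}"
  "p \<otimes>\<^bsub>poly_ring V\<^esub> q = p * q" "p \<oplus>\<^bsub>poly_ring V\<^esub> q = p + q"
  "\<zero>\<^bsub>poly_ring V\<^esub> = 0" "\<one>\<^bsub>poly_ring V\<^esub> = 1"
  by (simp_all add: poly_ring_def)

lemma cring_poly_ring: "cring (poly_ring V :: ('v, 'a::comm_ring_1) mpoly ring)"
proof (rule cringI)
  show "abelian_group (poly_ring V :: ('v, 'a) mpoly ring)"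
  proof (rule abelian_groupI)
    fix p :: "('v, 'a) mpoly" assume "p \<in> carrier (poly_ring V)"
    then show "\<exists>q\<in>carrier (poly_ring V). q \<oplus>\<^bsub>poly_ring V\<^esub> p = \<zero>\<^bsub>poly_ring V\<^esub>"
      by (intro bexI[of _ "- p"]) simp_all
  qed (use indets_add in \<open>force simp: ac_simps\<close>)+
  show "comm_monoid (poly_ring V :: ('v, 'a) mpoly ring)"
    by (rule comm_monoidI) (use indets_mult in \<open>force simp: ac_simps\<close>)+
qed (simp add: distrib_right)

lemma ring_poly_ring: "ring (poly_ring V :: ('v, 'a::comm_ring_1) mpoly ring)"
  using cring_poly_ring by (rule cring.axioms(1))

lemma poly_ring_idealI:
  fixes I :: "('v, 'a::comm_ring_1) mpoly set"
  assumes "I \<subseteq> carrier (poly_ring V)" "0 \<in> I"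
    and add: "\<And>p q. p \<in> I \<Longrightarrow> q \<in> I \<Longrightarrow> p + q \<in> I"
    and mult: "\<And>p q. p \<in> carrier (poly_ring V) \<Longrightarrow> q \<in> I \<Longrightarrow> p * q \<in> I"
  shows "ideal I (poly_ring V)"
proof -
  interpret R: cring "poly_ring V :: ('v, 'a) mpoly ring"
    by (rule cring_poly_ring)
  show ?thesis
  proof (rule idealI)
    show "subgroup I (add_monoid (poly_ring V))"
    proof (rule R.add.subgroupI)
      fix p assume p: "p \<in> I"
      then have "p \<in> carrier (poly_ring V)" "- p \<in> carrier (poly_ring V)"
        using assms(1) by auto
      then have "\<ominus>\<^bsub>poly_ring V\<^esub> p = - p"
        by (intro R.minus_equality) simp_all
      moreover have "- p \<in> I"
        using mult[of "- 1" p] p by simp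
      ultimately show "\<ominus>\<^bsub>poly_ring V\<^esub> p \<in> I"
        by simp
    qed (use assms in auto)
  next
    fix p q :: "('v, 'a) mpoly" assume "p \<in> I" "q \<in> carrier (poly_ring V)"
    then have "q * p \<in> I" by (intro mult)
    then show "q \<otimes>\<^bsub>poly_ring V\<^esub> p \<in> I" "p \<otimes>\<^bsub>poly_ring V\<^esub> q \<in> I"
      by (simp_all add: mult.commute)
  qed (rule ring_poly_ring)
qed

lemma coeff_ideal_of_ideal:
  fixes I :: "('v, 'a::comm_ring_1) mpoly set"
  assumes "ideal I (poly_ring V)"
  shows "coeff_ideal (carrier (poly_ring V)) I"
proof -
  interpret ideal I "poly_ring V" by fact
  have mult: "p * q \<in> I" if "p \<in> carrier (poly_ring V)" "q \<in> I" for p q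
    using I_l_closed[OF that(2,1)] by simp
  have diff: "p - q \<in> I" if "p \<in> I" "q \<in> I" for p q
    using additive_subgroup.a_closed[OF ideal.axioms(1)[OF assms] that(1) mult[of "- 1" q]] that(2)
    by simp
  show ?thesis
  proof
    fix p q :: "('v, 'a) mpoly"
    assume "p \<in> carrier (poly_ring V)" "q \<in> carrier (poly_ring V)"
    then show "p - q \<in> carrier (poly_ring V)" "p * q \<in> carrier (poly_ring V)"
      using indets_add[of p "- q"] indets_mult[of p q] by auto
  next
    show "0 \<in> I" using additive_subgroup.zero_closed[OF ideal.axioms(1)[OF assms]] by simp
  qed (use mult diff in auto)
qed

lemma coeff_ideal_carrier:
  "coeff_ideal (carrier (poly_ring V)) (carrier (poly_ring V :: ('v, 'a::comm_ring_1) mpoly ring))"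
  by (rule coeff_ideal_of_ideal[OF ring.oneideal[OF ring_poly_ring]])

lemma Idl_subset_larger_ring:
  fixes G :: "('v, 'a::comm_ring_1) mpoly set"
  assumes G: "G \<subseteq> carrier (poly_ring V)" and VW: "V \<subseteq> W"
  shows "Idl\<^bsub>poly_ring V\<^esub> G \<subseteq> Idl\<^bsub>poly_ring W\<^esub> G"
proof -
  have G': "G \<subseteq> carrier (poly_ring W)"
    using G VW by auto
  interpret W: ideal "Idl\<^bsub>poly_ring W\<^esub> G" "poly_ring W"
    by (rule ring.genideal_ideal[OF ring_poly_ring G'])
  interpret V: cring "poly_ring V :: ('v, 'a) mpoly ring"
    by (rule cring_poly_ring)
  have "ideal (Idl\<^bsub>poly_ring W\<^esub> G \<inter> carrier (poly_ring V)) (poly_ring V)"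
  proof (rule poly_ring_idealI)
    fix p q :: "('v, 'a) mpoly"
    assume p: "p \<in> carrier (poly_ring V)" and q: "q \<in> Idl\<^bsub>poly_ring W\<^esub> G \<inter> carrier (poly_ring V)"
    have "p \<in> carrier (poly_ring W)"
      using p VW by auto
    then show "p * q \<in> Idl\<^bsub>poly_ring W\<^esub> G \<inter> carrier (poly_ring V)"
      using W.I_l_closed[of q p] V.m_closed[of p q] p q by simp
  next
    fix p q :: "('v, 'a) mpoly"
    assume "p \<in> Idl\<^bsub>poly_ring W\<^esub> G \<inter> carrier (poly_ring V)"
      "q \<in> Idl\<^bsub>poly_ring W\<^esub> G \<inter> carrier (poly_ring V)"
    then show "p + q \<in> Idl\<^bsub>poly_ring W\<^esub> G \<inter> carrier (poly_ring V)"
      using additive_subgroup.a_closed[OF W.additive_subgroup_axioms, of p q] V.a_closed[of p q]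
      by simp
  qed (use additive_subgroup.zero_closed[OF W.additive_subgroup_axioms] in auto)
  moreover have "G \<subseteq> Idl\<^bsub>poly_ring W\<^esub> G \<inter> carrier (poly_ring V)"
    using ring.genideal_self[OF ring_poly_ring G'] G by blast
  ultimately show ?thesis
    using ring.genideal_minimal[OF ring_poly_ring] by blast
qed

context term_order_ideal
begin

text \<open>
  The polynomials without a term in \<open>\<O>\<close> form an ideal, as \<open>\<O>\<close> is closed under divisors.
\<close>

lemma mon_in_compl_ideal_iff:
  "(mon t 1 :: ('x, 'k::field) mpoly) \<in> compl_ideal \<O> \<longleftrightarrow> t \<notin> \<O>"
proof
  assume "t \<notin> \<O>"
  then show "(mon t 1 :: ('x, 'k) mpoly) \<in> compl_ideal \<O>"
    unfolding compl_ideal_def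
    by (intro subsetD[OF ring.genideal_self[OF ring_poly_ring]]) auto
next
  let ?J = "{p :: ('x, 'k) mpoly. supp p \<inter> \<O> = {}}"
  have "ideal ?J (poly_ring UNIV)"
  proof (rule poly_ring_idealI)
    fix p q :: "('x, 'k) mpoly"
    assume "p \<in> ?J" "q \<in> ?J"
    then show "p + q \<in> ?J"
      using Poly_Mapping.keys_add[of p q] by blast
  next
    fix p q :: "('x, 'k) mpoly"
    assume "q \<in> ?J"
    then show "p * q \<in> ?J"
      using supp_mult_subset[of p q] factor_in(2) by blast
  qed auto
  then have "compl_ideal \<O> \<subseteq> ?J"
    unfolding compl_ideal_def by (rule ring.genideal_minimal[OF ring_poly_ring]) auto
  moreover assume "(mon t 1 :: ('x, 'k) mpoly) \<in> compl_ideal \<O>"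
  ultimately have "(mon t 1 :: ('x, 'k) mpoly) \<in> ?J" by blast
  then show "t \<notin> \<O>" by simp
qed

lemma pommaret_basis_eq: "pommaret_basis TYPE('k::field) \<O> = P"
  using P_nonzero by (auto simp: pommaret_basis_def mon_in_compl_ideal_iff P_def)

end

section \<open>Generic marked sets\<close>

lemma trm_deg_eq_0_iff: "trm_deg t = 0 \<longleftrightarrow> t = (0 :: 'v trm)"
  by (auto simp: trm_deg_def in_keys_iff intro!: poly_mapping_eqI)

text \<open>
  A later term of \<open>ts\<close> that divided an earlier one would have smaller degree. Hence a border
  term can always be reduced by its own marked polynomial with multiplier 1.
\<close>

lemma zero_in_border_mult:
  assumes "distinct ts" "sorted (map trm_deg ts)"
  shows "0 \<in> border_mult ts \<tau>"
proof -
  have False if ij: "i < j" "j < length ts" and dvd: "trm_dvd (ts ! j) (ts ! i)" for i j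
  proof -
    from dvd obtain u where u: "ts ! i = ts ! j + u"
      by (auto simp: trm_dvd_def)
    have "trm_deg (ts ! i) \<le> trm_deg (ts ! j)"
      using assms(2) ij by (auto simp: sorted_iff_nth_mono)
    then have "u = 0"
      by (simp add: u trm_deg_add trm_deg_eq_0_iff)
    then show False
      using u ij assms(1) by (simp add: nth_eq_iff_index_eq)
  qed
  then show ?thesis
    by (auto simp: border_mult_def)
qed

definition index_of :: "'a list \<Rightarrow> 'a \<Rightarrow> nat" where
  "index_of xs x = (THE i. i < length xs \<and> xs ! i = x)"

lemma index_of_nth: "distinct xs \<Longrightarrow> i < length xs \<Longrightarrow> index_of xs (xs ! i) = i"
  unfolding index_of_def by (rule the_equality) (auto simp: nth_eq_iff_index_eq)

definition generic_tail ::
  "'x trm list \<Rightarrow> 'x trm list \<Rightarrow> 'x trm \<Rightarrow> ('x, 'k::field cpoly) mpoly" where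
  "generic_tail ts ss \<tau> = (\<Sum>j<length ss. mon (ss ! j) (mon (Var (index_of ts \<tau>, j)) 1))"

lemma coef_generic_tail:
  assumes "distinct ss" "j < length ss"
  shows "coef (generic_tail ts ss \<tau>) (ss ! j) = mon (Var (index_of ts \<tau>, j)) 1"
proof -
  have "coef (generic_tail ts ss \<tau>) (ss ! j) =
      (\<Sum>i<length ss. if i = j then mon (Var (index_of ts \<tau>, j)) 1 else 0)"
    unfolding generic_tail_def lookup_sum
    by (rule sum.cong) (use assms in \<open>auto simp: lookup_single when_def nth_eq_iff_index_eq\<close>)
  then show ?thesis
    using assms(2) by simp
qed

lemma supp_generic_tail: "supp (generic_tail ts ss \<tau>) \<subseteq> set ss"
proof -
  have "supp (mon (ss ! j) (mon (Var (index_of ts \<tau>, j)) 1 :: 'k::field cpoly)) \<subseteq> set ss"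
    if "j < length ss" for j
    using that by simp
  then show ?thesis
    unfolding generic_tail_def using Poly_Mapping.keys_sum by fast
qed

lemma coeffs_generic_tail:
  assumes "{index_of ts \<tau>} \<times> {..<length ss} \<subseteq> V"
  shows "coeffs_in (carrier (poly_ring V)) (generic_tail ts ss \<tau> :: ('x, 'k::field cpoly) mpoly)"
proof -
  interpret coeff_ideal "carrier (poly_ring V)" "carrier (poly_ring V :: 'k cpoly ring)"
    by (rule coeff_ideal_carrier)
  have "mon (Var (index_of ts \<tau>, j)) 1 \<in> carrier (poly_ring V :: 'k cpoly ring)"
    if "j < length ss" for j
    using assms that by (auto simp: indets_mon)
  then show ?thesis
    unfolding generic_tail_def
    by (intro coeffs_ring_sum) (simp only: coeffs_ring_simps lessThan_iff)
qed

section \<open>The ideals of the border and the Pommaret marked scheme\<close>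

theorem theorem4p1:
  fixes \<O> :: "('x::{finite,linorder}) trm set"
    and ts ss :: "'x trm list"
    and BB PP :: "('k::field) cpoly set"
    and C Ctilde :: "(nat \<times> nat) set"
  assumes "order_ideal \<O>" and "finite \<O>"
    and "distinct ss" and "set ss = \<O>"
    and "distinct ts" and "set ts = border \<O>" and "sorted (map trm_deg ts)"
  defines "C \<equiv> params ts ss"
    and "Ctilde \<equiv> params_tilde TYPE('k) ts ss"
    and "BB \<equiv> border_scheme_ideal ts ss"
    and "PP \<equiv> pommaret_scheme_ideal ts ss"
  shows "\<exists>B' :: 'k cpoly set. \<exists>q :: nat \<times> nat \<Rightarrow> 'k cpoly.
      (\<forall>c\<in>Ctilde. q c \<in> carrier (poly_ring (C - Ctilde))) \<and>
      B' = Idl\<^bsub>poly_ring C\<^esub> {Poly_Mapping.single (Var c) 1 - q c | c. c \<in> Ctilde} \<and>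
      BB = (Idl\<^bsub>poly_ring C\<^esub> PP) <+>\<^bsub>poly_ring C\<^esub> B'"
proof -
  define N where "N = (generic_tail ts ss :: 'x trm \<Rightarrow> ('x, 'k cpoly) mpoly)"
  interpret term_order_ideal \<O>
    by unfold_locales fact
  interpret marked_border \<O> N
    by unfold_locales (use supp_generic_tail[of ts ss] assms(4) in \<open>simp add: N_def\<close>)
  interpret R: cring "poly_ring C :: 'k cpoly ring"
    by (rule cring_poly_ring)
  interpret R': cring "poly_ring (C - Ctilde) :: 'k cpoly ring"
    by (rule cring_poly_ring)
  let ?S = "carrier (poly_ring C) :: 'k cpoly set"
  let ?S' = "carrier (poly_ring (C - Ctilde)) :: 'k cpoly set"
  interpret S': coeff_ideal ?S' ?S'
    by (rule coeff_ideal_carrier)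
  have border_nth: "\<exists>i<length ts. ts ! i = \<tau>" if "\<tau> \<in> border \<O>" for \<tau>
    using that assms(6) by (auto simp: in_set_conv_nth)
  have b_eq: "gen_marked ts ss i = b (ts ! i)" if "i < length ts" for i
    unfolding gen_marked_def b_def unfolding N_def generic_tail_def
    using that assms(5) by (simp add: index_of_nth)
  have border_set: "border_marked_set ts ss = {(\<tau>, b \<tau>) | \<tau>. \<tau> \<in> border \<O>}"
  proof -
    have "border_marked_set ts ss = {(ts ! i, b (ts ! i)) | i. i < length ts}"
      unfolding border_marked_set_def by (rule Collect_cong) (metis b_eq)
    then show ?thesis
      unfolding assms(6)[symmetric] set_conv_nth by auto
  qed
  have P_eq: "pommaret_basis TYPE('k) (set ss) = P"
    by (simp add: assms(4) pommaret_basis_eq)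
  have pommaret_set: "pommaret_marked_set ts ss = pommaret_marked"
  proof -
    have "pommaret_marked_set ts ss = {(ts ! i, b (ts ! i)) | i. i < length ts \<and> ts ! i \<in> P}"
      unfolding pommaret_marked_set_def P_eq by (rule Collect_cong) (metis b_eq)
    also have "\<dots> = {(\<alpha>, b \<alpha>) | \<alpha>. \<alpha> \<in> P}"
      using border_nth P_subset_border by blast
    finally show ?thesis
      unfolding pommaret_marked_def .
  qed
  have tails: "coeffs_in ?S (N \<tau>)" if \<tau>: "\<tau> \<in> border \<O>" for \<tau>
    unfolding N_def
    by (rule coeffs_generic_tail)
      (use border_nth[OF \<tau>] index_of_nth[OF assms(5)] in \<open>auto simp: C_def params_def\<close>)
  have P_tails: "coeffs_in ?S' (N \<alpha>)" if \<alpha>: "\<alpha> \<in> P" for \<alpha>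
    unfolding N_def
    by (rule coeffs_generic_tail)
      (use border_nth[OF subsetD[OF P_subset_border \<alpha>]] \<alpha> index_of_nth[OF assms(5)] in
        \<open>auto simp: C_def Ctilde_def params_def params_tilde_def P_eq\<close>)
  have nf: "coeffs_in ?S' (nf t)" for t
    by (rule coeffs_nf[OF coeff_ideal_carrier P_tails])
  have sub: "?S' \<subseteq> ?S" by auto

  define q :: "nat \<times> nat \<Rightarrow> 'k cpoly" where "q = (\<lambda>(i, j). coef (nf (ts ! i)) (ss ! j))"
  have q: "q c \<in> ?S'" for c
    using nf by (cases c) (simp add: q_def coeffs_in_def)
  define Q where "Q = {mon (Var c) 1 - q c | c. c \<in> Ctilde}"
  have Q_carrier: "Q \<subseteq> ?S"
  proof -
    interpret S: coeff_ideal ?S ?S by (rule coeff_ideal_carrier)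
    have "mon (Var c) 1 \<in> ?S" if "c \<in> Ctilde" for c
      using that by (auto simp: indets_mon Ctilde_def C_def params_tilde_def)
    then show ?thesis
      unfolding Q_def using S.diff_in q sub by blast
  qed

  define GB where "GB = {coef h t | h t. \<exists>p\<in>border_marked_set ts ss. \<exists>q\<in>border_marked_set ts ss.
    neighbour (fst p) (fst q) \<and>
    reduces_to (border_marked_set ts ss) (border_mult ts) (set ss) (spoly p q) (h :: ('x, 'k cpoly) mpoly)}"
  define GP where "GP = {coef h t | h t. \<exists>p\<in>pommaret_marked_set ts ss. \<exists>q\<in>pommaret_marked_set ts ss.
    nonmult_couple (fst p) (fst q) \<and>
    reduces_to (pommaret_marked_set ts ss) pommaret_mult (set ss) (spoly p q) (h :: ('x, 'k cpoly) mpoly)}"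
  have GB_I: "coef h t \<in> GB"
    if "p \<in> border_marked_set ts ss" "q \<in> border_marked_set ts ss" "neighbour (fst p) (fst q)"
      "reduces_to (border_marked_set ts ss) (border_mult ts) (set ss) (spoly p q) h" for p q h t
    unfolding GB_def using that by blast
  have GP_I: "coef h t \<in> GP"
    if "p \<in> pommaret_marked_set ts ss" "q \<in> pommaret_marked_set ts ss" "nonmult_couple (fst p) (fst q)"
      "reduces_to (pommaret_marked_set ts ss) pommaret_mult (set ss) (spoly p q) h" for p q h t
    unfolding GP_def using that by blast
  have BB: "BB = Idl\<^bsub>poly_ring C\<^esub> GB"
    by (simp add: BB_def border_scheme_ideal_def GB_def C_def)
  have PP: "PP = Idl\<^bsub>poly_ring (C - Ctilde)\<^esub> GP"
    by (simp add: PP_def pommaret_scheme_ideal_def GP_def C_def Ctilde_def)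

  have GB_subset: "GB \<subseteq> I"
    if "marked_mod \<O> N ?S I" and f: "marked_mod.normal_form_map \<O> N ?S I f" for I f
  proof -
    interpret I: marked_mod \<O> N ?S I by fact
    show ?thesis
    proof
      fix c assume "c \<in> GB"
      then obtain h t \<tau> \<tau>' where c: "c = coef h t" and \<tau>: "\<tau> \<in> border \<O>" "\<tau>' \<in> border \<O>"
        and h: "reduces_to {(\<tau>, b \<tau>) | \<tau>. \<tau> \<in> border \<O>} (border_mult ts) \<O>
          (spoly (\<tau>, b \<tau>) (\<tau>', b \<tau>')) h"
        unfolding GB_def border_set assms(4) by blast
      from I.reduced_spoly_in_ideal[OF f subset_refl \<tau> h] show "c \<in> I"
        by (simp add: c coeffs_in_def)
    qed
  qed
  have GP_subset: "GP \<subseteq> I"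
    if "marked_mod \<O> N ?S I" and f: "marked_mod.normal_form_map \<O> N ?S I f" for I f
  proof -
    interpret I: marked_mod \<O> N ?S I by fact
    have "pommaret_marked \<subseteq> {(\<tau>, b \<tau>) | \<tau>. \<tau> \<in> border \<O>}"
      using P_subset_border by (auto simp: pommaret_marked_def)
    note * = I.reduced_spoly_in_ideal[OF f this]
    show ?thesis
    proof
      fix c assume "c \<in> GP"
      then obtain h t \<alpha> \<alpha>' where c: "c = coef h t" and \<alpha>: "\<alpha> \<in> P" "\<alpha>' \<in> P"
        and h: "reduces_to pommaret_marked pommaret_mult \<O> (spoly (\<alpha>, b \<alpha>) (\<alpha>', b \<alpha>')) h"
        unfolding GP_def pommaret_set assms(4) by (auto simp: pommaret_marked_def)
      then have "coeffs_in I h"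
        using *[OF _ _ h] P_subset_border by blast
      then show "c \<in> I"
        by (simp add: c coeffs_in_def)
    qed
  qed

  \<comment> \<open>both inclusions of the theorem need the generators to lie in the rings that carry the ideals\<close>
  have GB_carrier: "GB \<subseteq> ?S"
  proof -
    interpret S: marked_mod \<O> N ?S ?S
      by (intro marked_mod.intro marked_mod_axioms.intro coeff_ideal_carrier marked_border_axioms tails)
    \<comment> \<open>modulo the unit ideal everything is congruent, and \<open>GB_subset\<close> becomes a statement on carriers\<close>
    have "S.normal_form_map (\<lambda>_. 0)"
      unfolding S.normal_form_map_def S.cong_mod_def lin_ext_def mult_zero_right sum.neutral_const
      by (intro conjI allI ballI S.coeffs_ring_diff) (simp_all only: S.coeffs_ring_simps S.one_in)
    then show ?thesis
      by (rule GB_subset[OF S.marked_mod_axioms])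
  qed
  have GP_carrier: "GP \<subseteq> ?S'"
  proof
    fix c assume "c \<in> GP"
    then obtain h t \<alpha> \<alpha>' where c: "c = coef h t" and \<alpha>: "\<alpha> \<in> P" "\<alpha>' \<in> P"
      and h: "reduces_to pommaret_marked pommaret_mult \<O> (spoly (\<alpha>, b \<alpha>) (\<alpha>', b \<alpha>')) h"
      unfolding GP_def pommaret_set assms(4) by (auto simp: pommaret_marked_def)
    have mon: "coeffs_in ?S' (mon \<eta> 1 :: ('x, 'k cpoly) mpoly)" for \<eta>
      using S'.coeffs_ring_simps(2)[of \<eta> 1] S'.one_in by blast
    have "coeffs_in ?S' (b \<alpha>)" if "\<alpha> \<in> P" for \<alpha>
      unfolding b_def by (intro S'.coeffs_ring_diff mon P_tails that)
    then have "coeffs_in ?S' (spoly (\<alpha>, b \<alpha>) (\<alpha>', b \<alpha>'))"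
      using \<alpha> unfolding spoly_def fst_conv snd_conv
      by (intro S'.coeffs_ring_diff S'.coeffs_ring_mult mon) auto
    then have "coeffs_in ?S' (L (spoly (\<alpha>, b \<alpha>) (\<alpha>', b \<alpha>')))"
      unfolding L_def by (intro S'.coeffs_ring_lin_ext nf)
    moreover have "h = L (spoly (\<alpha>, b \<alpha>) (\<alpha>', b \<alpha>'))"
      using h rtranclp_pommaret_L L_fixed unfolding reduces_to_def by metis
    ultimately show "c \<in> ?S'"
      by (simp add: c coeffs_in_def)
  qed

  have BB_ideal: "ideal BB (poly_ring C)"
    unfolding BB by (rule R.genideal_ideal[OF GB_carrier])
  have Q_ideal: "ideal (Idl\<^bsub>poly_ring C\<^esub> Q) (poly_ring C)"
    by (rule R.genideal_ideal[OF Q_carrier])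
  have PP_carrier: "PP \<subseteq> ?S"
    using ideal.Icarr[OF R'.genideal_ideal[OF GP_carrier]] sub unfolding PP by blast
  have PP_ideal: "ideal (Idl\<^bsub>poly_ring C\<^esub> PP) (poly_ring C)"
    by (rule R.genideal_ideal[OF PP_carrier])
  define I where "I = (Idl\<^bsub>poly_ring C\<^esub> PP) <+>\<^bsub>poly_ring C\<^esub> (Idl\<^bsub>poly_ring C\<^esub> Q)"
  have I_Idl: "I = Idl\<^bsub>poly_ring C\<^esub> (Idl\<^bsub>poly_ring C\<^esub> PP \<union> Idl\<^bsub>poly_ring C\<^esub> Q)"
    unfolding I_def by (rule R.union_genideal[OF PP_ideal Q_ideal, symmetric])
  have I_ideal: "ideal I (poly_ring C)"
    unfolding I_def by (rule R.add_ideals[OF PP_ideal Q_ideal])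
  have gens_in_I: "GP \<subseteq> I" "Q \<subseteq> I"
  proof -
    have "Idl\<^bsub>poly_ring C\<^esub> PP \<union> Idl\<^bsub>poly_ring C\<^esub> Q \<subseteq> ?S"
      using ideal.Icarr[OF PP_ideal] ideal.Icarr[OF Q_ideal] by blast
    then have "Idl\<^bsub>poly_ring C\<^esub> PP \<union> Idl\<^bsub>poly_ring C\<^esub> Q \<subseteq> I"
      unfolding I_Idl by (rule R.genideal_self)
    then show "GP \<subseteq> I" "Q \<subseteq> I"
      using R.genideal_self[OF Q_carrier] R.genideal_self[OF PP_carrier]
        R'.genideal_self[OF GP_carrier] unfolding PP by blast+
  qed

  have "I \<subseteq> BB"
  proof -
    interpret B: marked_mod \<O> N ?S BB
      by (intro marked_mod.intro marked_mod_axioms.intro coeff_ideal_of_ideal[OF BB_ideal]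
        marked_border_axioms tails)
    \<comment> \<open>the commutators have coefficients among the generators of \<open>\<BB>\<close>\<close>
    have "B.normal_form_map op_nf"
    proof (intro B.op_nf_normal_form_map B.mult_ops_commute)
      fix \<tau> \<tau>' assume \<tau>: "\<tau> \<in> border \<O>" "\<tau>' \<in> border \<O>" "neighbour \<tau> \<tau>'"
        and "supp (spoly (\<tau>, b \<tau>) (\<tau>', b \<tau>')) \<subseteq> \<O> \<union> border \<O>"
      then have red: "reduces_to (border_marked_set ts ss) (border_mult ts) (set ss)
          (spoly (\<tau>, b \<tau>) (\<tau>', b \<tau>')) (lin_ext border_nf (spoly (\<tau>, b \<tau>) (\<tau>', b \<tau>')))"
        unfolding border_set assms(4)
        by (intro border_reduces_to_border_nf zero_in_border_mult assms)
      have "coef (lin_ext border_nf (spoly (\<tau>, b \<tau>) (\<tau>', b \<tau>'))) t \<in> GB" for t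
        by (rule GB_I[OF _ _ _ red]) (use \<tau> in \<open>simp_all add: border_set\<close>)
      then show "B.cong_mod (lin_ext border_nf (spoly (\<tau>, b \<tau>) (\<tau>', b \<tau>'))) 0"
        using R.genideal_self[OF GB_carrier] unfolding B.cong_0_iff coeffs_in_def BB[symmetric]
        by blast
    qed
    note map = this
    have "PP \<subseteq> Idl\<^bsub>poly_ring C\<^esub> GP"
      unfolding PP by (rule Idl_subset_larger_ring[OF GP_carrier]) auto
    also have "\<dots> \<subseteq> BB"
      by (rule R.genideal_minimal[OF BB_ideal GP_subset[OF B.marked_mod_axioms map]])
    finally have "Idl\<^bsub>poly_ring C\<^esub> PP \<subseteq> BB"
      by (rule R.genideal_minimal[OF BB_ideal])
    moreover have "Q \<subseteq> BB"
    proof -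
      have "mon (Var (i, j)) 1 - q (i, j) \<in> BB" if "(i, j) \<in> Ctilde" for i j
      proof -
        from that have ij: "i < length ts" "j < length ss"
          by (auto simp: Ctilde_def params_tilde_def params_def)
        then have "B.cong_mod (N (ts ! i)) (nf (ts ! i))"
          using B.tail_cong_nf[OF map] assms(6) nth_mem by blast
        then have "coef (N (ts ! i)) (ss ! j) - coef (nf (ts ! i)) (ss ! j) \<in> BB"
          by (simp add: B.cong_mod_def coeffs_in_def lookup_minus)
        then show ?thesis
          using ij by (simp add: N_def coef_generic_tail[OF assms(3)] index_of_nth[OF assms(5)] q_def)
      qed
      then show ?thesis
        unfolding Q_def by auto
    qed
    then have "Idl\<^bsub>poly_ring C\<^esub> Q \<subseteq> BB"
      by (rule R.genideal_minimal[OF BB_ideal])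
    ultimately show ?thesis
      unfolding I_Idl by (intro R.genideal_minimal[OF BB_ideal]) blast
  qed

  moreover have "BB \<subseteq> I"
  proof -
    interpret M: marked_mod \<O> N ?S I
      by (intro marked_mod.intro marked_mod_axioms.intro coeff_ideal_of_ideal[OF I_ideal]
        marked_border_axioms tails)
    \<comment> \<open>the generators of \<open>\<PP>\<close> and of \<open>\<BB>'\<close> are the two hypotheses of \<open>nf_normal_form_map\<close>\<close>
    have "M.normal_form_map nf"
    proof (rule M.nf_normal_form_map)
      fix \<alpha> x assume \<alpha>: "\<alpha> \<in> P" "Var x \<notin> pommaret_mult \<alpha>"
      define \<alpha>' where "\<alpha>' = cone_head (Var x + \<alpha>)"
      note sp = L_spoly[OF \<alpha>, folded \<alpha>'_def]
      have "coef (L (mon (Var x) 1 * b \<alpha>)) t \<in> GP" for t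
        unfolding sp(3)[symmetric]
      proof (rule GP_I)
        show "(\<alpha>, b \<alpha>) \<in> pommaret_marked_set ts ss" "(\<alpha>', b \<alpha>') \<in> pommaret_marked_set ts ss"
          using \<alpha>(1) sp(2) unfolding pommaret_set pommaret_marked_def by blast+
        show "nonmult_couple (fst (\<alpha>, b \<alpha>)) (fst (\<alpha>', b \<alpha>'))"
          using sp(1) by simp
        show "reduces_to (pommaret_marked_set ts ss) pommaret_mult (set ss)
            (spoly (\<alpha>, b \<alpha>) (\<alpha>', b \<alpha>')) (L (spoly (\<alpha>, b \<alpha>) (\<alpha>', b \<alpha>')))"
          unfolding pommaret_set assms(4) by (rule pommaret_reduces_to_L)
      qed
      then show "M.cong_mod (L (mon (Var x) 1 * b \<alpha>)) 0"
        using gens_in_I by (auto simp: M.cong_0_iff coeffs_in_def)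
    next
      fix \<tau> assume \<tau>: "\<tau> \<in> border \<O>"
      show "M.cong_mod (N \<tau>) (nf \<tau>)"
      proof (cases "\<tau> \<in> P")
        case True
        then show ?thesis by (simp add: nf_pommaret)
      next
        case False
        from border_nth[OF \<tau>] obtain i where i: "i < length ts" "ts ! i = \<tau>" by blast
        have "coef (N \<tau>) t - coef (nf \<tau>) t \<in> I" for t
        proof (cases "t \<in> \<O>")
          case True
          then obtain j where j: "j < length ss" "t = ss ! j"
            using assms(4) by (auto simp: in_set_conv_nth)
          then have "(i, j) \<in> Ctilde"
            using i False by (simp add: Ctilde_def params_tilde_def params_def P_eq)
          then have "mon (Var (i, j)) 1 - q (i, j) \<in> I"
            using gens_in_I(2) unfolding Q_def by blast
          then show ?thesis
            using i j index_of_nth[OF assms(5) i(1)]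
            by (simp add: N_def coef_generic_tail[OF assms(3)] q_def)
        next
          case False
          then have "coef (N \<tau>) t = 0" "coef (nf \<tau>) t = 0"
            using tail_supp[OF \<tau>] supp_nf[of \<tau>] by (auto simp: in_keys_iff)
          then show ?thesis using M.zero_ideal by simp
        qed
        then show ?thesis
          by (simp add: M.cong_mod_def coeffs_in_def lookup_minus)
      qed
    qed
    then have "GB \<subseteq> I"
      by (rule GB_subset[OF M.marked_mod_axioms])
    then show ?thesis
      unfolding BB by (rule R.genideal_minimal[OF I_ideal])
  qed

  ultimately have "BB = I" by blast
  show ?thesis
  proof (intro exI conjI ballI)
    show "q c \<in> ?S'" for c
      by (rule q)
    show "Idl\<^bsub>poly_ring C\<^esub> Q = Idl\<^bsub>poly_ring C\<^esub> {mon (Var c) 1 - q c | c. c \<in> Ctilde}"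
      unfolding Q_def ..
    show "BB = (Idl\<^bsub>poly_ring C\<^esub> PP) <+>\<^bsub>poly_ring C\<^esub> (Idl\<^bsub>poly_ring C\<^esub> Q)"
      using \<open>BB = I\<close> unfolding I_def .
  qed
qed

end
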